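(* Let $\kappa>0$ and let $Z$ be a $\kappa$-self-similar Markov process with transition function $P$. Let $\psi$ be the Laplace exponent of a subordinator $\zeta$, and for $u\ge1$ let $G_u$ be the law of $R_u:=\exp(-\zeta_{\ln u})$. Then there exists a Markov process $X=(X_t)_{t\ge0}$ with $X_0=0$ and transition function \[ \widetilde P(0,t,0,\mathrm{d}y)=P(0,t,0,\mathrm{d}y),\qquad \widetilde P(s,t,x,\mathrm{d}y)=\mathbb{E}\bigl[P\bigl(R_{t/s}t,\,t,\,(t/s)^{\kappa}R_{t/s}^{\kappa}x,\,\mathrm{d}y\bigr)\bigr],\quad 0<s\le t, \] which is $\kappa$-self-similar and has the same one-dimensional marginal distributions as $Z$. Furthermore, if $Z$ is a martingale and $\psi(\kappa)=\kappa$ (equivalently $\mathbb{E}[R_{t/s}^\kappa]=(s/t)^\kappa$ for all $0<s\le t$), then $X$ is also a martingale.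
   Context: $Z=(Z_t)_{t\ge0}$ is a real-valued càdlàg Markov process that is $\kappa$-self-similar: $(Z_{ct})_{t\ge0}\stackrel{d}{=}(c^\kappa Z_t)_{t\ge0}$ in finite-dimensional distributions for all $c>0$ (so $Z_0=0$); $P(s,t,x,\mathrm{d}y)=\mathbb{P}(Z_t\in\mathrm{d}y\mid Z_s=x)$. A subordinator is a process with nonnegative, independent and stationary increments started at $0$; its Laplace exponent $\psi$ is defined by $\mathbb{E}[e^{-\lambda\zeta_a}]=\exp(-a\psi(\lambda))$, $\lambda\ge0$, and has the form $\psi(\lambda)=\beta\lambda+\int_0^\infty(1-e^{-\lambda x})\nu(\mathrm{d}x)$ with drift $\beta\ge0$ and Lévy measure $\nu$ ($\nu(\{0\})=0$, $\int(1\wedge x)\nu(\mathrm{d}x)<\infty$). *)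

theory Defs
  imports "HOL-Probability.Probability"
begin

text \<open>Processes are indexed by real time; only times t \<ge> 0 are relevant.
  Time-inhomogeneous transition functions are families P s t x of measures on the reals.\<close>

definition cadlag_path :: "(real \<Rightarrow> real) \<Rightarrow> bool" where
  "cadlag_path f \<longleftrightarrow>
     (\<forall>t\<ge>0. continuous (at_right t) f \<and> (t > 0 \<longrightarrow> (\<exists>l. (f \<longlongrightarrow> l) (at_left t))))"

definition nat_filtration :: "'a measure \<Rightarrow> (real \<Rightarrow> 'a \<Rightarrow> real) \<Rightarrow> real \<Rightarrow> 'a set set" where
  "nat_filtration M X s =
     sigma_sets (space M) {X r -` B \<inter> space M | r B. 0 \<le> r \<and> r \<le> s \<and> B \<in> sets borel}"

definition markov_kernels :: "(real \<Rightarrow> real \<Rightarrow> real \<Rightarrow> real measure) \<Rightarrow> bool" where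
  "markov_kernels P \<longleftrightarrow>
     (\<forall>s t x. 0 \<le> s \<longrightarrow> s \<le> t \<longrightarrow> prob_space (P s t x) \<and> sets (P s t x) = sets borel) \<and>
     (\<forall>s t B. 0 \<le> s \<longrightarrow> s \<le> t \<longrightarrow> B \<in> sets borel \<longrightarrow>
        (\<lambda>x. measure (P s t x) B) \<in> borel_measurable borel)"

text \<open>Joint measurability of (r,x) \<mapsto> P(r,t,x,B) for r \<in> [0,t] (needed for the
  mixture formula defining the new transition function to make sense).\<close>
definition jointly_measurable_kernels :: "(real \<Rightarrow> real \<Rightarrow> real \<Rightarrow> real measure) \<Rightarrow> bool" where
  "jointly_measurable_kernels P \<longleftrightarrow>
     (\<forall>t B. 0 \<le> t \<longrightarrow> B \<in> sets borel \<longrightarrow>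
        (\<lambda>(r, x). measure (P r t x) B)
          \<in> borel_measurable (restrict_space (borel \<Otimes>\<^sub>M borel) ({0..t} \<times> UNIV)))"

text \<open>X is a Markov process (w.r.t. its natural filtration) with transition function P:
  P(X_t \<in> B | F_s) = P(s,t,X_s,B), written without conditional expectations.\<close>
definition markov_process :: "'a measure \<Rightarrow> (real \<Rightarrow> 'a \<Rightarrow> real)
    \<Rightarrow> (real \<Rightarrow> real \<Rightarrow> real \<Rightarrow> real measure) \<Rightarrow> bool" where
  "markov_process M X P \<longleftrightarrow>
     prob_space M \<and> (\<forall>t\<ge>0. X t \<in> borel_measurable M) \<and> markov_kernels P \<and>
     (\<forall>s t A B. 0 \<le> s \<longrightarrow> s \<le> t \<longrightarrow> A \<in> nat_filtration M X s \<longrightarrow> B \<in> sets borel \<longrightarrow>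
        measure M (A \<inter> (X t -` B \<inter> space M)) = (LINT \<omega>:A|M. measure (P s t (X s \<omega>)) B))"

definition self_similar :: "'a measure \<Rightarrow> (real \<Rightarrow> 'a \<Rightarrow> real) \<Rightarrow> real \<Rightarrow> bool" where
  "self_similar M X \<kappa> \<longleftrightarrow>
     (\<forall>c>0. \<forall>J. finite J \<longrightarrow> J \<subseteq> {0..} \<longrightarrow>
        distr M (PiM J (\<lambda>_. borel)) (\<lambda>\<omega>. \<lambda>t\<in>J. X (c * t) \<omega>)
      = distr M (PiM J (\<lambda>_. borel)) (\<lambda>\<omega>. \<lambda>t\<in>J. c powr \<kappa> * X t \<omega>))"

definition martingale :: "'a measure \<Rightarrow> (real \<Rightarrow> 'a \<Rightarrow> real) \<Rightarrow> bool" where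
  "martingale M X \<longleftrightarrow>
     (\<forall>t\<ge>0. integrable M (X t)) \<and>
     (\<forall>s t A. 0 \<le> s \<longrightarrow> s \<le> t \<longrightarrow> A \<in> nat_filtration M X s \<longrightarrow>
        (LINT \<omega>:A|M. X t \<omega>) = (LINT \<omega>:A|M. X s \<omega>))"

definition subordinator :: "'b measure \<Rightarrow> (real \<Rightarrow> 'b \<Rightarrow> real) \<Rightarrow> bool" where
  "subordinator N \<zeta> \<longleftrightarrow>
     prob_space N \<and> (\<forall>t\<ge>0. \<zeta> t \<in> borel_measurable N) \<and>
     (AE \<omega> in N. \<zeta> 0 \<omega> = 0) \<and>
     (\<forall>s t. 0 \<le> s \<longrightarrow> s \<le> t \<longrightarrow> (AE \<omega> in N. \<zeta> s \<omega> \<le> \<zeta> t \<omega>)) \<and>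
     (\<forall>(n::nat) (\<tau>::nat \<Rightarrow> real). 0 \<le> \<tau> 0 \<longrightarrow> (\<forall>i<n. \<tau> i \<le> \<tau> (Suc i)) \<longrightarrow>
        prob_space.indep_vars N (\<lambda>_. borel) (\<lambda>i \<omega>. \<zeta> (\<tau> (Suc i)) \<omega> - \<zeta> (\<tau> i) \<omega>) {..<n}) \<and>
     (\<forall>s h. 0 \<le> s \<longrightarrow> 0 \<le> h \<longrightarrow>
        distr N borel (\<lambda>\<omega>. \<zeta> (s + h) \<omega> - \<zeta> s \<omega>) = distr N borel (\<zeta> h))"

definition laplace_exponent :: "'b measure \<Rightarrow> (real \<Rightarrow> 'b \<Rightarrow> real) \<Rightarrow> (real \<Rightarrow> real) \<Rightarrow> bool" where
  "laplace_exponent N \<zeta> \<psi> \<longleftrightarrow>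
     (\<forall>a\<ge>0. \<forall>l\<ge>0. (\<integral>\<omega>. exp (- l * \<zeta> a \<omega>) \<partial>N) = exp (- a * \<psi> l))"

definition R_law :: "'b measure \<Rightarrow> (real \<Rightarrow> 'b \<Rightarrow> real) \<Rightarrow> real \<Rightarrow> real measure" where
  "R_law N \<zeta> u = distr N borel (\<lambda>\<omega>. exp (- \<zeta> (ln u) \<omega>))"

text \<open>The new transition function:
  Pt(0,t,x) = P(0,t,x) (only x = 0 matters since X_0 = 0),
  Pt(s,t,x,dy) = E[P(R t, t, (t/s)^kappa R^kappa x, dy)] with R ~ G(t/s), for 0 < s.\<close>
definition ss_transition :: "real \<Rightarrow> (real \<Rightarrow> real \<Rightarrow> real \<Rightarrow> real measure)
    \<Rightarrow> (real \<Rightarrow> real measure) \<Rightarrow> real \<Rightarrow> real \<Rightarrow> real \<Rightarrow> real measure" where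
  "ss_transition \<kappa> P G s t x =
     (if s = 0 then P 0 t x
      else measure_of UNIV (sets borel)
        (\<lambda>B. \<integral>\<^sup>+ r. emeasure (P (r * t) t ((t / s) powr \<kappa> * r powr \<kappa> * x)) B \<partial>(G (t / s))))"

end

theory Submission
  imports Defs
begin

text \<open>The Lamperti transform \<open>V b = exp (- \<kappa> * b) * Z (exp b)\<close> is stationary. Subordinating it by an
  independent copy of \<open>\<zeta>\<close> started at logarithmic time \<open>a\<close> gives, on the product space, the process
  \<open>Y a t = t powr \<kappa> * V (\<zeta> (ln t - a))\<close> for \<open>t \<ge> exp a\<close>; it is measurable because the paths of \<open>Z\<close> are
  right-continuous. By stationarity of \<open>V\<close> and of the increments of \<open>\<zeta>\<close>, the finite-dimensional laws
  of \<open>Y a\<close> do not depend on \<open>a\<close>, so letting \<open>a\<close> tend to \<open>-\<infinity>\<close> they form a projective family, and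
  Kolmogorov's theorem yields \<open>X\<close>. The Markov and martingale properties hold for \<open>V\<close> along every
  fixed nondecreasing time change; integrating over \<open>\<zeta>\<close>, whose next increment is independent of its past,
  gives them for \<open>Y a\<close>, with \<open>R = exp (- (\<zeta> (ln t - a) - \<zeta> (ln s - a)))\<close> in the kernel. Chapman--Kolmogorov
  equations, which hold only almost everywhere here, are never used.\<close>

text \<open>The transition formula comes from one change of scale. Given \<open>\<zeta>\<close>,
  between times \<open>s\<close> and \<open>t\<close> the process \<open>V\<close> moves from some
  \<open>b\<close> to \<open>b + d\<close>, with \<open>d\<close> an increment of
  \<open>\<zeta>\<close>. Translating so that \<open>b + d\<close> becomes \<open>ln t\<close>
  places the start at real time \<open>t * exp (- d)\<close>, that is \<open>R * t\<close>, and the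
  state \<open>x = s powr \<kappa> * V b\<close> becomes the value
  \<open>(t / s) powr \<kappa> * R powr \<kappa> * x\<close> of \<open>Z\<close> there. The
  martingale condition is the same bookkeeping: the move costs a factor
  \<open>exp (- \<kappa> * d)\<close>, whose mean must be \<open>(s / t) powr \<kappa>\<close> to
  balance the weights \<open>t powr \<kappa>\<close> and \<open>s powr \<kappa>\<close>. Two
  obstacles shape the proof. Time 0 is logarithmic time minus infinity, where the subordinator has
  no starting point; hence the level \<open>a\<close> and the separate treatment of
  \<open>s = 0\<close>. And \<open>P s t x\<close> is constrained only for almost every
  \<open>x\<close> under the law of \<open>Z s\<close>, so kernels can be neither composed nor
  rescaled pointwise; the Markov property is therefore carried in integrated form, tested on
  cylinder events.\<close>

section \<open>Cylinder sets and the natural filtration\<close>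

lemma cylinder_in_nat_filtration:
  assumes "finite J" "J \<subseteq> {0..s}" and E: "E \<in> sets (PiM J (\<lambda>_. borel))"
  shows "{\<omega> \<in> space M. (\<lambda>t\<in>J. X t \<omega>) \<in> E} \<in> nat_filtration M X s"
proof -
  let ?G = "{X r -` B \<inter> space M | r B. 0 \<le> r \<and> r \<le> s \<and> B \<in> sets borel}"
  have G: "?G \<subseteq> Pow (space M)" by auto
  let ?F = "sigma (space M) ?G"
  have "X t \<in> measurable ?F borel" if "t \<in> J" for t
  proof (rule measurableI)
    fix B :: "real set" assume "B \<in> sets borel"
    then show "X t -` B \<inter> space ?F \<in> sets ?F"
      using that assms(2) G by (auto simp: subset_iff intro!: sigma_sets.Basic)
  qed auto
  then have "(\<lambda>\<omega>. \<lambda>t\<in>J. X t \<omega>) \<in> measurable ?F (PiM J (\<lambda>_. borel))"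
    by (rule measurable_restrict)
  from measurable_sets[OF this E] G show ?thesis
    unfolding nat_filtration_def by (simp add: vimage_def Int_def conj_commute)
qed

text \<open>Dynkin's argument: the events on which the two integrals agree form a Dynkin class, and
  the cylinders form an intersection-stable generator. Cylinders are the right tests because
  \<open>X\<close> will be known only through its finite-dimensional laws. Demanding
  \<open>s \<in> J\<close> makes the current state \<open>X s\<close> a function of the tested
  coordinates.\<close>

lemma nat_filtration_set_integral_eqI:
  fixes X :: "real \<Rightarrow> 'c \<Rightarrow> real" and U W :: "'c \<Rightarrow> real"
  assumes meas: "\<And>t. 0 \<le> t \<Longrightarrow> X t \<in> borel_measurable M"
    and int: "integrable M U" "integrable M W"
    and s: "0 \<le> s"
    and cyl: "\<And>J E. finite J \<Longrightarrow> J \<subseteq> {0..s} \<Longrightarrow> s \<in> J \<Longrightarrow> E \<in> sets (PiM J (\<lambda>_. borel)) \<Longrightarrow>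
      (\<integral>\<omega>. indicator E (\<lambda>t\<in>J. X t \<omega>) * U \<omega> \<partial>M) = (\<integral>\<omega>. indicator E (\<lambda>t\<in>J. X t \<omega>) * W \<omega> \<partial>M)"
    and A: "A \<in> nat_filtration M X s"
  shows "(LINT \<omega>:A|M. U \<omega>) = (LINT \<omega>:A|M. W \<omega>)"
proof -
  define G where "G = {{\<omega> \<in> space M. (\<lambda>t\<in>J. X t \<omega>) \<in> E} | J E.
    finite J \<and> J \<subseteq> {0..s} \<and> s \<in> J \<and> E \<in> sets (PiM J (\<lambda>_. borel :: real measure))}"
  have G_sub: "G \<subseteq> Pow (space M)" by (auto simp: G_def)
  have Xm: "(\<lambda>\<omega>. \<lambda>t\<in>J. X t \<omega>) \<in> measurable M (PiM J (\<lambda>_. borel))" if "J \<subseteq> {0..s}" for J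
    using that by (intro measurable_restrict meas) auto
  have G_sets: "G \<subseteq> sets M"
  proof
    fix a assume "a \<in> G"
    then obtain J E where "a = {\<omega> \<in> space M. (\<lambda>t\<in>J. X t \<omega>) \<in> E}" "J \<subseteq> {0..s}"
      "E \<in> sets (PiM J (\<lambda>_. borel :: real measure))"
      unfolding G_def by blast
    then show "a \<in> sets M"
      using measurable_sets[OF Xm[of J], of E] by (simp add: vimage_def Int_def conj_commute)
  qed
  have stable: "Int_stable G"
  proof (rule Int_stableI)
    fix a b assume "a \<in> G" "b \<in> G"
    then obtain J E K F where
      a: "a = {\<omega> \<in> space M. (\<lambda>t\<in>J. X t \<omega>) \<in> E}" "finite J" "J \<subseteq> {0..s}" "s \<in> J"
         "E \<in> sets (PiM J (\<lambda>_. borel :: real measure))" and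
      b: "b = {\<omega> \<in> space M. (\<lambda>t\<in>K. X t \<omega>) \<in> F}" "finite K" "K \<subseteq> {0..s}" "s \<in> K"
         "F \<in> sets (PiM K (\<lambda>_. borel :: real measure))"
      unfolding G_def by blast
    let ?L = "J \<union> K"
    \<comment> \<open>Both cylinders are lifted to the common index set before they are
      intersected.\<close>
    let ?H = "prod_emb ?L (\<lambda>_. borel) J E \<inter> prod_emb ?L (\<lambda>_. borel) K F"
    have "?H \<in> sets (PiM ?L (\<lambda>_. borel :: real measure))"
      using a b by (intro sets.Int measurable_prod_emb) auto
    moreover have "a \<inter> b = {\<omega> \<in> space M. (\<lambda>t\<in>?L. X t \<omega>) \<in> ?H}"
      by (auto simp: a(1) b(1) prod_emb_def restrict_restrict Int_absorb1 Un_Int_distrib)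
    ultimately show "a \<inter> b \<in> G"
      unfolding G_def using a b by (intro CollectI exI[of _ ?L] exI[of _ ?H]) auto
  qed
  have "A \<in> sigma_sets (space M) G"
  proof -
    have "{X r -` B \<inter> space M | r B. 0 \<le> r \<and> r \<le> s \<and> B \<in> sets borel} \<subseteq> G"
    proof clarify
      fix r and B :: "real set" assume r: "0 \<le> r" "r \<le> s" "B \<in> sets borel"
      let ?E = "(\<lambda>x. x r) -` B \<inter> space (PiM {r, s} (\<lambda>_. borel :: real measure))"
      have "?E \<in> sets (PiM {r, s} (\<lambda>_. borel :: real measure))"
        using r by (intro measurable_sets[OF measurable_component_singleton]) auto
      moreover have "X r -` B \<inter> space M = {\<omega> \<in> space M. (\<lambda>t\<in>{r, s}. X t \<omega>) \<in> ?E}"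
        by (auto simp: space_PiM)
      ultimately show "X r -` B \<inter> space M \<in> G"
        unfolding G_def using r s by (intro CollectI exI[of _ "{r, s}"] exI[of _ ?E]) auto
    qed
    then show ?thesis
      using A sigma_sets_mono' unfolding nat_filtration_def by blast
  qed
  from stable G_sub this show ?thesis
  proof (induction rule: sigma_sets_induct_disjoint)
    case (basic a)
    then obtain J E where a: "a = {\<omega> \<in> space M. (\<lambda>t\<in>J. X t \<omega>) \<in> E}" "finite J" "J \<subseteq> {0..s}" "s \<in> J"
         "E \<in> sets (PiM J (\<lambda>_. borel :: real measure))"
      unfolding G_def by blast
    have "(LINT \<omega>:a|M. f \<omega>) = (\<integral>\<omega>. indicator E (\<lambda>t\<in>J. X t \<omega>) * f \<omega> \<partial>M)" for f :: "'c \<Rightarrow> real"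
      unfolding set_lebesgue_integral_def a(1)
      by (intro Bochner_Integration.integral_cong) (auto simp: indicator_def)
    then show ?case using cyl[OF a(2-)] by simp
  next
    case empty
    then show ?case by (simp add: set_lebesgue_integral_def)
  next
    case (compl a)
    then have [measurable]: "a \<in> sets M"
      using sets.sigma_sets_subset[OF G_sets] by blast
    \<comment> \<open>Passing to complements needs equal total integrals; the cylinder over
      \<open>{s}\<close> with full base is the whole space.\<close>
    have whole: "(\<integral>\<omega>. U \<omega> \<partial>M) = (\<integral>\<omega>. W \<omega> \<partial>M)"
    proof -
      let ?E = "space (PiM {s} (\<lambda>_. borel :: real measure))"
      have "(\<integral>\<omega>. indicator ?E (\<lambda>t\<in>{s}. X t \<omega>) * U \<omega> \<partial>M)
          = (\<integral>\<omega>. indicator ?E (\<lambda>t\<in>{s}. X t \<omega>) * W \<omega> \<partial>M)"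
        using s by (intro cyl) auto
      then show ?thesis by (simp add: space_PiM)
    qed
    have "(LINT \<omega>:space M - a|M. f \<omega>) = (\<integral>\<omega>. f \<omega> \<partial>M) - (LINT \<omega>:a|M. f \<omega>)"
      if "integrable M f" for f :: "'c \<Rightarrow> real"
    proof -
      have "(LINT \<omega>:space M - a|M. f \<omega>) = (\<integral>\<omega>. f \<omega> - indicator a \<omega> * f \<omega> \<partial>M)"
        unfolding set_lebesgue_integral_def
        by (intro Bochner_Integration.integral_cong) (auto simp: indicator_def)
      also have "\<dots> = (\<integral>\<omega>. f \<omega> \<partial>M) - (LINT \<omega>:a|M. f \<omega>)"
        unfolding set_lebesgue_integral_def real_scaleR_def
        using that integrable_mult_indicator[of a M f]
        by (intro Bochner_Integration.integral_diff) auto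
      finally show ?thesis .
    qed
    then show ?case using int whole compl by simp
  next
    case (union S)
    then have S: "\<And>i. S i \<in> sets M"
      using sets.sigma_sets_subset[OF G_sets] by blast
    have "(LINT \<omega>:(\<Union>i. S i)|M. f \<omega>) = (\<Sum>i. LINT \<omega>:S i|M. f \<omega>)"
      if "integrable M f" for f :: "'c \<Rightarrow> real"
      using that S union(1) integrable_mult_indicator[of "\<Union>i. S i" M f]
      by (intro lebesgue_integral_countable_add) (auto simp: disjoint_family_on_def set_integrable_def)
    then show ?case using int union by simp
  qed
qed

text \<open>Turns the probabilities in the Markov property into expectations, so that it can be
  treated like the martingale property. If the event is not measurable, both sides are 0 by
  convention.\<close>

lemma measure_Int_vimage_eq_set_integral:
  "measure M (A \<inter> (f -` B \<inter> space M)) = (LINT \<omega>:A|M. indicator B (f \<omega>))"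
proof -
  have "(LINT \<omega>:A|M. indicator B (f \<omega>)) = (\<integral>\<omega>. indicator (A \<inter> (f -` B \<inter> space M)) \<omega> \<partial>M)"
    unfolding set_lebesgue_integral_def
    by (intro Bochner_Integration.integral_cong) (auto simp: indicator_def)
  also have "\<dots> = measure M (A \<inter> (f -` B \<inter> space M) \<inter> space M)"
    by simp
  finally show ?thesis by (simp add: Int_assoc)
qed

lemma distr_eq_compose:
  assumes "distr M K f = distr M' K f'" "f \<in> measurable M K" "f' \<in> measurable M' K" "g \<in> measurable K L"
  shows "distr M L (\<lambda>x. g (f x)) = distr M' L (\<lambda>x. g (f' x))"
proof -
  have "distr M L (\<lambda>x. g (f x)) = distr (distr M K f) L g"
    using assms(2,4) by (simp add: distr_distr comp_def)
  also have "\<dots> = distr M' L (\<lambda>x. g (f' x))"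
    unfolding assms(1) using assms(3,4) by (simp add: distr_distr comp_def)
  finally show ?thesis .
qed

lemma distr_cong_AE':
  assumes "f \<in> measurable M K" "g \<in> measurable M K" "AE x in M. f x = g x"
  shows "distr M K f = distr M K g"
proof (rule measure_eqI)
  fix A assume "A \<in> sets (distr M K f)"
  then show "emeasure (distr M K f) A = emeasure (distr M K g) A"
    using assms by (auto simp: emeasure_distr intro!: emeasure_eq_AE)
qed simp

section \<open>Increments of a subordinator\<close>

text \<open>Independence of increments is stated along nondecreasing sequences, so finitely many
  times are embedded in a grid from 0 to \<open>\<sigma>\<close>. Repeated points are allowed, and
  \<open>0 < n\<close> is kept even for empty \<open>U\<close> because the product-law
  characterisation of independence is applied to a nonempty index set. The induction adds the
  largest time \<open>b\<close>: a grid ending at \<open>b\<close> is extended by the point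
  \<open>\<sigma>\<close>.\<close>

lemma finite_set_grid:
  fixes U :: "real set"
  assumes "finite U" "U \<subseteq> {0..\<sigma>}" "0 \<le> \<sigma>"
  shows "\<exists>(n::nat) u. 0 < n \<and> u 0 = 0 \<and> u n = \<sigma> \<and> (\<forall>i<n. u i \<le> u (Suc i)) \<and> U \<subseteq> u ` {..n}"
  using assms
proof (induction U arbitrary: \<sigma> rule: finite_linorder_max_induct)
  case empty
  then show ?case
    by (intro exI[of _ 1] exI[of _ "\<lambda>i. if i = 0 then 0 else \<sigma>"]) auto
next
  case (insert b A)
  have "0 \<le> b" "A \<subseteq> {0..b}"
    using insert by (auto simp: subset_iff less_imp_le)
  with insert.IH[of b] obtain n u where
    u: "0 < n" "u 0 = 0" "u n = b" "\<forall>i<n. u i \<le> u (Suc i)" "A \<subseteq> u ` {..n}"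
    by blast
  define w where "w = u(Suc n := \<sigma>)"
  have "w i \<le> w (Suc i)" if "i < Suc n" for i
    using that u insert.prems by (cases "i = n") (auto simp: w_def)
  moreover have "insert b A \<subseteq> w ` {..Suc n}"
  proof
    fix x assume "x \<in> insert b A"
    then have "x \<in> u ` {..n}" using u(3,5) by auto
    then obtain i where "i \<le> n" "x = u i" by auto
    then show "x \<in> w ` {..Suc n}"
      by (intro image_eqI[of _ _ i]) (auto simp: w_def)
  qed
  ultimately show ?case
    using u by (intro exI[of _ "Suc n"] exI[of _ w]) (auto simp: w_def)
qed

text \<open>Independence is kept in the form "joint law equals product law", on which Fubini's
  theorem can act directly.\<close>

lemma (in prob_space) distr_pair_indep_map:
  assumes F: "F \<in> measurable M S" and G: "G \<in> measurable M T"
    and f: "f \<in> measurable S S'" and g: "g \<in> measurable T T'"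
    and ind: "distr M S F \<Otimes>\<^sub>M distr M T G = distr M (S \<Otimes>\<^sub>M T) (\<lambda>x. (F x, G x))"
  shows "distr M S' (\<lambda>x. f (F x)) \<Otimes>\<^sub>M distr M T' (\<lambda>x. g (G x)) = distr M (S' \<Otimes>\<^sub>M T') (\<lambda>x. (f (F x), g (G x)))"
proof -
  interpret B: prob_space "distr M T' (\<lambda>x. g (G x))"
    by (intro prob_space_distr measurable_compose[OF G g])
  have B: "distr (distr M T G) T' g = distr M T' (\<lambda>x. g (G x))"
    using g G by (simp add: distr_distr comp_def)
  have A: "distr (distr M S F) S' f = distr M S' (\<lambda>x. f (F x))"
    using f F by (simp add: distr_distr comp_def)
  have fg: "(\<lambda>(x, y). (f x, g y)) \<in> measurable (S \<Otimes>\<^sub>M T) (S' \<Otimes>\<^sub>M T')"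
    unfolding split_beta'
    by (intro measurable_Pair measurable_compose[OF measurable_fst f] measurable_compose[OF measurable_snd g])
  have FG: "(\<lambda>x. (F x, G x)) \<in> measurable M (S \<Otimes>\<^sub>M T)"
    by (intro measurable_Pair F G)
  have f': "f \<in> measurable (distr M S F) S'" and g': "g \<in> measurable (distr M T G) T'"
    using f g by auto
  have sf: "sigma_finite_measure (distr (distr M T G) T' g)"
    unfolding B by unfold_locales
  have "distr M S' (\<lambda>x. f (F x)) \<Otimes>\<^sub>M distr M T' (\<lambda>x. g (G x))
      = distr (distr M S F \<Otimes>\<^sub>M distr M T G) (S' \<Otimes>\<^sub>M T') (\<lambda>(x, y). (f x, g y))"
    unfolding A[symmetric] B[symmetric] by (rule pair_measure_distr[OF f' g' sf])
  also have "\<dots> = distr M (S' \<Otimes>\<^sub>M T') ((\<lambda>(x, y). (f x, g y)) \<circ> (\<lambda>x. (F x, G x)))"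
    unfolding ind by (rule distr_distr[OF fg FG])
  finally show ?thesis by (simp add: comp_def)
qed

locale subordinator_process =
  fixes N :: "'b measure" and \<zeta> :: "real \<Rightarrow> 'b \<Rightarrow> real"
  assumes sub: "subordinator N \<zeta>"
begin

sublocale N: prob_space N
  using sub by (simp add: subordinator_def)

lemma zeta_measurable [measurable]: "0 \<le> t \<Longrightarrow> \<zeta> t \<in> borel_measurable N"
  using sub by (simp add: subordinator_def)

lemma zeta_0: "AE \<omega> in N. \<zeta> 0 \<omega> = 0"
  using sub by (simp add: subordinator_def)

lemma zeta_mono: "0 \<le> s \<Longrightarrow> s \<le> t \<Longrightarrow> AE \<omega> in N. \<zeta> s \<omega> \<le> \<zeta> t \<omega>"
  using sub by (simp add: subordinator_def)

lemma zeta_nonneg: "0 \<le> t \<Longrightarrow> AE \<omega> in N. 0 \<le> \<zeta> t \<omega>"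
  using zeta_0 zeta_mono[of 0 t] by auto

lemma zeta_indep_increments:
  assumes "0 \<le> \<tau> 0" "\<And>i. i < n \<Longrightarrow> \<tau> i \<le> \<tau> (Suc i)"
  shows "N.indep_vars (\<lambda>_. borel) (\<lambda>i \<omega>. \<zeta> (\<tau> (Suc i)) \<omega> - \<zeta> (\<tau> i) \<omega>) {..<n::nat}"
  using sub assms by (simp add: subordinator_def)

lemma zeta_stationary:
  "0 \<le> s \<Longrightarrow> 0 \<le> h \<Longrightarrow> distr N borel (\<lambda>\<omega>. \<zeta> (s + h) \<omega> - \<zeta> s \<omega>) = distr N borel (\<zeta> h)"
  using sub by (simp add: subordinator_def)

lemma grid_nonneg:
  fixes u :: "nat \<Rightarrow> real"
  assumes "u 0 = 0" "\<And>i. i < n \<Longrightarrow> u i \<le> u (Suc i)"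
  shows "i \<le> n \<Longrightarrow> 0 \<le> u i"
proof (induction i)
  case (Suc i)
  then show ?case using assms(2)[of i] by simp
qed (simp add: assms)

text \<open>Independence makes the joint law a product, and stationarity removes \<open>v\<close>
  from every factor. That the right-hand side is free of \<open>v\<close> is what yields shift
  invariance below.\<close>

lemma distr_increments:
  fixes u :: "nat \<Rightarrow> real"
  assumes v: "0 \<le> v" and n: "0 < n" and u: "u 0 = 0" "\<And>i. i < n \<Longrightarrow> u i \<le> u (Suc i)"
  shows "distr N (PiM {..<n} (\<lambda>_. borel)) (\<lambda>\<omega>. \<lambda>i\<in>{..<n}. \<zeta> (v + u (Suc i)) \<omega> - \<zeta> (v + u i) \<omega>)
    = PiM {..<n} (\<lambda>i. distr N borel (\<zeta> (u (Suc i) - u i)))"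
proof -
  note pos = grid_nonneg[OF u]
  have "distr N (PiM {..<n} (\<lambda>_. borel)) (\<lambda>\<omega>. \<lambda>i\<in>{..<n}. \<zeta> (v + u (Suc i)) \<omega> - \<zeta> (v + u i) \<omega>)
    = PiM {..<n} (\<lambda>i. distr N borel (\<lambda>\<omega>. \<zeta> (v + u (Suc i)) \<omega> - \<zeta> (v + u i) \<omega>))"
  proof (subst N.indep_vars_iff_distr_eq_PiM'[symmetric])
    show "N.indep_vars (\<lambda>_. borel) (\<lambda>i \<omega>. \<zeta> (v + u (Suc i)) \<omega> - \<zeta> (v + u i) \<omega>) {..<n}"
      using zeta_indep_increments[of "\<lambda>i. v + u i" n] u v by simp
  qed (use n v pos in \<open>auto intro!: borel_measurable_diff zeta_measurable add_nonneg_nonneg\<close>)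
  also have "\<dots> = PiM {..<n} (\<lambda>i. distr N borel (\<zeta> (u (Suc i) - u i)))"
  proof (rule PiM_cong[OF refl])
    fix i assume "i \<in> {..<n}"
    then show "distr N borel (\<lambda>\<omega>. \<zeta> (v + u (Suc i)) \<omega> - \<zeta> (v + u i) \<omega>) = distr N borel (\<zeta> (u (Suc i) - u i))"
      using zeta_stationary[of "v + u i" "u (Suc i) - u i"] u(2)[of i] pos[of i] v by simp
  qed
  finally show ?thesis .
qed

lemma sum_increments:
  fixes u :: "nat \<Rightarrow> real"
  shows "u 0 = 0 \<Longrightarrow> (\<Sum>i<k. \<zeta> (v + u (Suc i)) \<omega> - \<zeta> (v + u i) \<omega>) = \<zeta> (v + u k) \<omega> - \<zeta> v \<omega>"
  using sum_lessThan_telescope[of "\<lambda>i. \<zeta> (v + u i) \<omega>" k] by simp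

lemma measurable_partial_sums:
  assumes "\<And>x. x \<in> U \<Longrightarrow> k x \<le> n"
  shows "(\<lambda>y. \<lambda>x\<in>U. \<Sum>i<k x. y i) \<in> measurable (PiM {..<n::nat} (\<lambda>_. borel)) (PiM U (\<lambda>_. borel :: real measure))"
  using assms by (intro measurable_restrict borel_measurable_sum measurable_component_singleton) force

text \<open>Relative to their value at \<open>v\<close>, the shifted values are partial sums of grid
  increments. The same summation map is applied to the increments at \<open>v\<close> and at 0,
  whose joint laws coincide.\<close>

lemma distr_zeta_shift:
  assumes U: "finite U" "U \<subseteq> {0..}" and v: "0 \<le> v"
  shows "distr N (PiM U (\<lambda>_. borel)) (\<lambda>\<omega>. \<lambda>x\<in>U. \<zeta> (v + x) \<omega> - \<zeta> v \<omega>)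
       = distr N (PiM U (\<lambda>_. borel)) (\<lambda>\<omega>. \<lambda>x\<in>U. \<zeta> x \<omega>)"
proof -
  \<comment> \<open>Inserting 0 keeps the maximum meaningful for empty \<open>U\<close>.\<close>
  define \<sigma> where "\<sigma> = Max (insert 0 U)"
  have "U \<subseteq> {0..\<sigma>}" "0 \<le> \<sigma>" using U by (auto simp: \<sigma>_def)
  from finite_set_grid[OF U(1) this] obtain n u where
    n: "0 < n" and u: "u 0 = 0" "\<And>i. i < n \<Longrightarrow> u i \<le> u (Suc i)" "U \<subseteq> u ` {..n}" by blast
  note pos = grid_nonneg[OF u(1,2)]
  from u(3) have "\<forall>x\<in>U. \<exists>i\<le>n. x = u i" by auto
  then obtain k where k: "\<And>x. x \<in> U \<Longrightarrow> k x \<le> n" "\<And>x. x \<in> U \<Longrightarrow> u (k x) = x" by metis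
  let ?D = "\<lambda>v \<omega>. \<lambda>i\<in>{..<n}. \<zeta> (v + u (Suc i)) \<omega> - \<zeta> (v + u i) \<omega>"
  let ?g = "\<lambda>y. \<lambda>x\<in>U. \<Sum>i<k x. y i :: real"
  have Dm: "?D v \<in> measurable N (PiM {..<n} (\<lambda>_. borel))" if "0 \<le> v" for v
    using pos that by (intro measurable_restrict borel_measurable_diff zeta_measurable add_nonneg_nonneg) auto
  have gD: "?g (?D v \<omega>) = (\<lambda>x\<in>U. \<zeta> (v + x) \<omega> - \<zeta> v \<omega>)" for v \<omega>
  proof (rule restrict_ext)
    fix x assume x: "x \<in> U"
    have "(\<Sum>i<k x. ?D v \<omega> i) = (\<Sum>i<k x. \<zeta> (v + u (Suc i)) \<omega> - \<zeta> (v + u i) \<omega>)"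
      using k(1)[OF x] by (intro sum.cong) auto
    then show "(\<Sum>i<k x. ?D v \<omega> i) = \<zeta> (v + x) \<omega> - \<zeta> v \<omega>"
      using sum_increments[of u v \<omega> "k x"] u(1) k(2)[OF x] by simp
  qed
  have "distr N (PiM U (\<lambda>_. borel)) (\<lambda>\<omega>. ?g (?D v \<omega>)) = distr N (PiM U (\<lambda>_. borel)) (\<lambda>\<omega>. ?g (?D 0 \<omega>))"
    using distr_increments[OF v n u(1,2)] distr_increments[OF order_refl n u(1,2)]
    by (intro distr_eq_compose[OF _ Dm[OF v] Dm[OF order_refl] measurable_partial_sums]) (auto simp: k)
  also have "\<dots> = distr N (PiM U (\<lambda>_. borel)) (\<lambda>\<omega>. \<lambda>x\<in>U. \<zeta> x \<omega>)"
    unfolding gD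
  proof (rule distr_cong_AE')
    show "AE \<omega> in N. (\<lambda>x\<in>U. \<zeta> (0 + x) \<omega> - \<zeta> 0 \<omega>) = (\<lambda>x\<in>U. \<zeta> x \<omega>)"
      using zeta_0 by eventually_elim simp
  qed (use U in \<open>auto intro!: measurable_restrict borel_measurable_diff zeta_measurable\<close>)
  finally show ?thesis unfolding gD .
qed

text \<open>Append \<open>\<sigma> + h\<close> to a grid ending at \<open>\<sigma>\<close>: the past
  values are functions of the first \<open>n\<close> increments, while the new increment has index
  \<open>n\<close> and forms an independent block.\<close>

lemma distr_zeta_past_increment:
  assumes U: "finite U" "U \<subseteq> {0..\<sigma>}" and \<sigma>: "0 \<le> \<sigma>" and h: "0 \<le> h"
  shows "distr N (PiM U (\<lambda>_. borel) \<Otimes>\<^sub>M borel) (\<lambda>\<omega>. (\<lambda>x\<in>U. \<zeta> x \<omega>, \<zeta> (\<sigma> + h) \<omega> - \<zeta> \<sigma> \<omega>))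
       = distr N (PiM U (\<lambda>_. borel)) (\<lambda>\<omega>. \<lambda>x\<in>U. \<zeta> x \<omega>) \<Otimes>\<^sub>M distr N borel (\<zeta> h)"
proof -
  from finite_set_grid[OF U \<sigma>] obtain n u where
    n: "0 < n" and u: "u 0 = 0" "\<And>i. i < n \<Longrightarrow> u i \<le> u (Suc i)" "U \<subseteq> u ` {..n}" "u n = \<sigma>" by blast
  from u(3) have "\<forall>x\<in>U. \<exists>i\<le>n. x = u i" by auto
  then obtain k where k: "\<And>x. x \<in> U \<Longrightarrow> k x \<le> n" "\<And>x. x \<in> U \<Longrightarrow> u (k x) = x" by metis
  define w where "w = u(Suc n := \<sigma> + h)"
  have w: "w 0 = 0" "\<And>i. i < Suc n \<Longrightarrow> w i \<le> w (Suc i)"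
    using u h by (auto simp: w_def less_Suc_eq)
  let ?I = "\<lambda>i \<omega>. \<zeta> (w (Suc i)) \<omega> - \<zeta> (w i) \<omega>"
  have "N.indep_vars (\<lambda>_. borel) ?I {..<Suc n}"
    using w by (intro zeta_indep_increments) auto
  then have ind: "N.indep_var (PiM {..<n} (\<lambda>_. borel)) (\<lambda>\<omega>. \<lambda>i\<in>{..<n}. ?I i \<omega>)
      (PiM {n} (\<lambda>_. borel)) (\<lambda>\<omega>. \<lambda>i\<in>{n}. ?I i \<omega>)"
    by (rule N.indep_var_restrict) auto
  let ?g = "\<lambda>y. \<lambda>x\<in>U. \<Sum>i<k x. y i :: real"
  have Im: "(\<lambda>\<omega>. \<lambda>i\<in>{..<n}. ?I i \<omega>) \<in> measurable N (PiM {..<n} (\<lambda>_. borel))"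
    "(\<lambda>\<omega>. \<lambda>i\<in>{n}. ?I i \<omega>) \<in> measurable N (PiM {n} (\<lambda>_. borel))"
    using ind by (auto simp: N.indep_var_distribution_eq)
  have gm: "?g \<in> measurable (PiM {..<n} (\<lambda>_. borel)) (PiM U (\<lambda>_. borel))"
    by (intro measurable_partial_sums k)
  have nm: "(\<lambda>z. z n :: real) \<in> measurable (PiM {n} (\<lambda>_. borel)) borel"
    by (intro measurable_component_singleton) simp
  have eq1: "?g (\<lambda>i\<in>{..<n}. ?I i \<omega>) = (\<lambda>x\<in>U. \<zeta> x \<omega> - \<zeta> 0 \<omega>)" for \<omega>
  proof (rule restrict_ext)
    fix x assume x: "x \<in> U"
    have "(\<Sum>i<k x. (\<lambda>i\<in>{..<n}. ?I i \<omega>) i) = (\<Sum>i<k x. \<zeta> (0 + u (Suc i)) \<omega> - \<zeta> (0 + u i) \<omega>)"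
      using k(1)[OF x] by (intro sum.cong) (auto simp: w_def)
    then show "(\<Sum>i<k x. (\<lambda>i\<in>{..<n}. ?I i \<omega>) i) = \<zeta> x \<omega> - \<zeta> 0 \<omega>"
      using sum_increments[of u 0 \<omega> "k x"] u(1) k(2)[OF x] by simp
  qed
  have eq2: "?I n \<omega> = \<zeta> (\<sigma> + h) \<omega> - \<zeta> \<sigma> \<omega>" for \<omega>
    using u by (auto simp: w_def)
  have "distr N (PiM U (\<lambda>_. borel)) (\<lambda>\<omega>. ?g (\<lambda>i\<in>{..<n}. ?I i \<omega>)) \<Otimes>\<^sub>M distr N borel (\<lambda>\<omega>. (\<lambda>i\<in>{n}. ?I i \<omega>) n)
    = distr N (PiM U (\<lambda>_. borel) \<Otimes>\<^sub>M borel) (\<lambda>\<omega>. (?g (\<lambda>i\<in>{..<n}. ?I i \<omega>), (\<lambda>i\<in>{n}. ?I i \<omega>) n))"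
    using ind unfolding N.indep_var_distribution_eq
    by (intro N.distr_pair_indep_map[OF Im gm nm]) blast
  then have "distr N (PiM U (\<lambda>_. borel)) (\<lambda>\<omega>. \<lambda>x\<in>U. \<zeta> x \<omega> - \<zeta> 0 \<omega>) \<Otimes>\<^sub>M
      distr N borel (\<lambda>\<omega>. \<zeta> (\<sigma> + h) \<omega> - \<zeta> \<sigma> \<omega>)
    = distr N (PiM U (\<lambda>_. borel) \<Otimes>\<^sub>M borel) (\<lambda>\<omega>. (\<lambda>x\<in>U. \<zeta> x \<omega> - \<zeta> 0 \<omega>, \<zeta> (\<sigma> + h) \<omega> - \<zeta> \<sigma> \<omega>))"
    unfolding eq1 by (simp add: eq2)
  moreover have m: "(\<lambda>\<omega>. \<lambda>x\<in>U. \<zeta> x \<omega> - \<zeta> 0 \<omega>) \<in> measurable N (PiM U (\<lambda>_. borel))"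
     "(\<lambda>\<omega>. \<lambda>x\<in>U. \<zeta> x \<omega>) \<in> measurable N (PiM U (\<lambda>_. borel))"
     "(\<lambda>\<omega>. \<zeta> (\<sigma> + h) \<omega> - \<zeta> \<sigma> \<omega>) \<in> borel_measurable N"
    using U \<sigma> h by (auto intro!: measurable_restrict borel_measurable_diff zeta_measurable)
  have "distr N (PiM U (\<lambda>_. borel)) (\<lambda>\<omega>. \<lambda>x\<in>U. \<zeta> x \<omega> - \<zeta> 0 \<omega>)
      = distr N (PiM U (\<lambda>_. borel)) (\<lambda>\<omega>. \<lambda>x\<in>U. \<zeta> x \<omega>)"
    using zeta_0 by (intro distr_cong_AE' m) (auto elim: AE_mp)
  moreover have "distr N (PiM U (\<lambda>_. borel) \<Otimes>\<^sub>M borel) (\<lambda>\<omega>. (\<lambda>x\<in>U. \<zeta> x \<omega> - \<zeta> 0 \<omega>, \<zeta> (\<sigma> + h) \<omega> - \<zeta> \<sigma> \<omega>))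
      = distr N (PiM U (\<lambda>_. borel) \<Otimes>\<^sub>M borel) (\<lambda>\<omega>. (\<lambda>x\<in>U. \<zeta> x \<omega>, \<zeta> (\<sigma> + h) \<omega> - \<zeta> \<sigma> \<omega>))"
    using zeta_0 by (intro distr_cong_AE' measurable_Pair m) (auto elim: AE_mp)
  ultimately show ?thesis
    using zeta_stationary[OF \<sigma> h] by simp
qed

lemma measurable_reindex:
  "(\<lambda>y. \<lambda>j\<in>J. y (\<tau> j)) \<in> measurable (PiM (\<tau> ` J) (\<lambda>_. M)) (PiM J (\<lambda>_. M))"
  by (intro measurable_restrict measurable_component_singleton) auto

lemma distr_zeta_shift_indexed:
  assumes J: "finite J" and \<tau>: "\<And>j. j \<in> J \<Longrightarrow> 0 \<le> \<tau> j" and v: "0 \<le> v"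
  shows "distr N (PiM J (\<lambda>_. borel)) (\<lambda>\<omega>. \<lambda>j\<in>J. \<zeta> (v + \<tau> j) \<omega> - \<zeta> v \<omega>)
       = distr N (PiM J (\<lambda>_. borel)) (\<lambda>\<omega>. \<lambda>j\<in>J. \<zeta> (\<tau> j) \<omega>)"
proof -
  have "distr N (PiM (\<tau> ` J) (\<lambda>_. borel)) (\<lambda>\<omega>. \<lambda>x\<in>\<tau> ` J. \<zeta> (v + x) \<omega> - \<zeta> v \<omega>)
      = distr N (PiM (\<tau> ` J) (\<lambda>_. borel)) (\<lambda>\<omega>. \<lambda>x\<in>\<tau> ` J. \<zeta> x \<omega>)"
    using assms by (intro distr_zeta_shift) auto
  moreover have "(\<lambda>\<omega>. \<lambda>x\<in>\<tau> ` J. \<zeta> (v + x) \<omega> - \<zeta> v \<omega>) \<in> measurable N (PiM (\<tau> ` J) (\<lambda>_. borel))"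
      "(\<lambda>\<omega>. \<lambda>x\<in>\<tau> ` J. \<zeta> x \<omega>) \<in> measurable N (PiM (\<tau> ` J) (\<lambda>_. borel))"
    using assms by (auto intro!: measurable_restrict borel_measurable_diff zeta_measurable)
  ultimately have "distr N (PiM J (\<lambda>_. borel)) (\<lambda>\<omega>. \<lambda>j\<in>J. (\<lambda>x\<in>\<tau> ` J. \<zeta> (v + x) \<omega> - \<zeta> v \<omega>) (\<tau> j))
      = distr N (PiM J (\<lambda>_. borel)) (\<lambda>\<omega>. \<lambda>j\<in>J. (\<lambda>x\<in>\<tau> ` J. \<zeta> x \<omega>) (\<tau> j))"
    by (rule distr_eq_compose[OF _ _ _ measurable_reindex])
  then show ?thesis by (simp cong: restrict_cong)
qed

lemma distr_zeta_past_increment_indexed: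
  assumes J: "finite J" and \<tau>: "\<And>j. j \<in> J \<Longrightarrow> 0 \<le> \<tau> j \<and> \<tau> j \<le> \<sigma>" and \<sigma>: "0 \<le> \<sigma>" and h: "0 \<le> h"
  shows "distr N (PiM J (\<lambda>_. borel) \<Otimes>\<^sub>M borel) (\<lambda>\<omega>. (\<lambda>j\<in>J. \<zeta> (\<tau> j) \<omega>, \<zeta> (\<sigma> + h) \<omega> - \<zeta> \<sigma> \<omega>))
       = distr N (PiM J (\<lambda>_. borel)) (\<lambda>\<omega>. \<lambda>j\<in>J. \<zeta> (\<tau> j) \<omega>) \<Otimes>\<^sub>M distr N borel (\<zeta> h)"
proof -
  let ?U = "\<tau> ` J"
  let ?f = "\<lambda>y. \<lambda>j\<in>J. y (\<tau> j) :: real"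
  have Um: "(\<lambda>\<omega>. \<lambda>x\<in>?U. \<zeta> x \<omega>) \<in> measurable N (PiM ?U (\<lambda>_. borel))"
    using \<tau> by (intro measurable_restrict) auto
  have f: "?f (\<lambda>x\<in>?U. \<zeta> x \<omega>) = (\<lambda>j\<in>J. \<zeta> (\<tau> j) \<omega>)" for \<omega>
    by (simp cong: restrict_cong)
  have inc [measurable]: "(\<lambda>\<omega>. \<zeta> (\<sigma> + h) \<omega> - \<zeta> \<sigma> \<omega>) \<in> borel_measurable N"
    using \<sigma> h by auto
  have "distr N (PiM J (\<lambda>_. borel)) (\<lambda>\<omega>. ?f (\<lambda>x\<in>?U. \<zeta> x \<omega>)) \<Otimes>\<^sub>M distr N borel (\<lambda>\<omega>. \<zeta> (\<sigma> + h) \<omega> - \<zeta> \<sigma> \<omega>)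
    = distr N (PiM J (\<lambda>_. borel) \<Otimes>\<^sub>M borel)
      (\<lambda>\<omega>. (?f (\<lambda>x\<in>?U. \<zeta> x \<omega>), \<zeta> (\<sigma> + h) \<omega> - \<zeta> \<sigma> \<omega>))"
    using distr_zeta_past_increment[of ?U \<sigma> h] \<tau> J \<sigma> h
    by (intro N.distr_pair_indep_map[OF Um inc measurable_reindex measurable_ident_sets[OF refl]])
       (auto simp: zeta_stationary image_subset_iff)
  then show ?thesis
    unfolding f by (simp add: zeta_stationary \<sigma> h)
qed

end

section \<open>The stationary Lamperti transform\<close>

locale subordinated_self_similar = subordinator_process N \<zeta>
  for N :: "'b measure" and \<zeta> :: "real \<Rightarrow> 'b \<Rightarrow> real" +
  fixes \<kappa> :: real and MZ :: "'a measure" and Z :: "real \<Rightarrow> 'a \<Rightarrow> real"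
    and P :: "real \<Rightarrow> real \<Rightarrow> real \<Rightarrow> real measure"
  assumes kappa_pos: "\<kappa> > 0"
    and Z_markov: "markov_process MZ Z P"
    and P_joint: "jointly_measurable_kernels P"
    and Z_cadlag: "\<forall>\<omega>\<in>space MZ. cadlag_path (\<lambda>t. Z t \<omega>)"
    and Z_ss: "self_similar MZ Z \<kappa>"
begin

sublocale MZ: prob_space MZ
  using Z_markov by (simp add: markov_process_def)

lemma Z_measurable [measurable]: "0 \<le> t \<Longrightarrow> Z t \<in> borel_measurable MZ"
  using Z_markov by (simp add: markov_process_def)

definition V :: "real \<Rightarrow> 'a \<Rightarrow> real" where
  "V b \<omega> = exp (- \<kappa> * b) * Z (exp b) \<omega>"

text \<open>This joint measurability is what makes \<open>V\<close> at a random time a random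
  variable. Right-continuity gives it by approximating \<open>exp b\<close> from the right by times
  on a grid of mesh \<open>1 / Suc n\<close>.\<close>

lemma Z_exp_measurable: "(\<lambda>(b :: real, \<omega>). Z (exp b) \<omega>) \<in> borel_measurable (borel \<Otimes>\<^sub>M MZ)"
proof (rule borel_measurable_LIMSEQ_real)
  \<comment> \<open>Adding 1 to the floor puts \<open>q n b\<close> strictly to the right of
    \<open>exp b\<close>, as convergence along \<open>at_right\<close> requires, and at distance at
    most \<open>1 / Suc n\<close>.\<close>
  define q where "q n b = (real_of_int \<lfloor>real (Suc n) * exp b\<rfloor> + 1) / real (Suc n)" for n and b :: real
  \<comment> \<open>Since \<open>q n b\<close> is positive, \<open>max 0\<close> leaves it
    unchanged; it makes each of the countably many candidate grid times nonnegative, where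
    \<open>Z\<close> is measurable.\<close>
  let ?u = "\<lambda>n (b :: real, \<omega>). Z (max 0 (q n b)) \<omega>"
  show "?u n \<in> borel_measurable (borel \<Otimes>\<^sub>M MZ)" for n
  proof -
    have "(\<lambda>p. Z (max 0 ((real_of_int \<lfloor>real (Suc n) * exp (fst p :: real)\<rfloor> + 1) / real (Suc n))) (snd p))
        \<in> borel_measurable (borel \<Otimes>\<^sub>M MZ)"
      by (rule measurable_compose_countable[where
            f = "\<lambda>i p. Z (max 0 ((real_of_int i + 1) / real (Suc n))) (snd p)"]) measurable
    then show ?thesis by (simp add: q_def split_beta')
  qed
  fix p :: "real \<times> 'a" assume "p \<in> space (borel \<Otimes>\<^sub>M MZ)"
  then obtain b \<omega> where p: "p = (b, \<omega>)" and \<omega>: "\<omega> \<in> space MZ"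
    by (auto simp: space_pair_measure)
  have q1: "exp b < q n b" for n
  proof -
    have "real (Suc n) * exp b < real_of_int \<lfloor>real (Suc n) * exp b\<rfloor> + 1" by linarith
    then show ?thesis by (simp add: q_def field_simps)
  qed
  have q2: "q n b \<le> exp b + inverse (real (Suc n))" for n
  proof -
    have "q n b \<le> (real (Suc n) * exp b + 1) / real (Suc n)"
      unfolding q_def by (intro divide_right_mono) auto
    also have "\<dots> = exp b + inverse (real (Suc n))"
      by (simp add: add_divide_distrib inverse_eq_divide del: of_nat_Suc)
    finally show ?thesis .
  qed
  have "(\<lambda>n. q n b) \<longlonglongrightarrow> exp b"
    by (rule tendsto_sandwich[OF _ _ tendsto_const LIMSEQ_inverse_real_of_nat_add])
       (use q1 q2 in \<open>auto intro!: always_eventually less_imp_le\<close>)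
  then have "filterlim (\<lambda>n. q n b) (at_right (exp b)) sequentially"
    using q1 by (auto simp: filterlim_at intro!: always_eventually dest: less_imp_neq[symmetric])
  moreover have "((\<lambda>t. Z t \<omega>) \<longlongrightarrow> Z (exp b) \<omega>) (at_right (exp b))"
    using Z_cadlag \<omega> by (auto simp: cadlag_path_def continuous_within)
  ultimately have "(\<lambda>n. Z (q n b) \<omega>) \<longlonglongrightarrow> Z (exp b) \<omega>"
    by (rule filterlim_compose[rotated])
  moreover have "max 0 (q n b) = q n b" for n
    using less_trans[OF exp_gt_zero q1[of n]] by simp
  ultimately show "(\<lambda>n. ?u n p) \<longlonglongrightarrow> (\<lambda>(b :: real, \<omega>). Z (exp b) \<omega>) p"
    by (simp add: p)
qed

lemma V_measurable_pair: "(\<lambda>(b, \<omega>). V b \<omega>) \<in> borel_measurable (borel \<Otimes>\<^sub>M MZ)"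
  using Z_exp_measurable unfolding V_def split_beta' by measurable

lemma V_measurable_compose [measurable (raw)]:
  assumes "f \<in> borel_measurable M" "g \<in> measurable M MZ"
  shows "(\<lambda>x. V (f x) (g x)) \<in> borel_measurable M"
  using measurable_compose[OF measurable_Pair[OF assms] V_measurable_pair] by simp

lemma Z_eq_V: "0 < t \<Longrightarrow> Z t \<omega> = t powr \<kappa> * V (ln t) \<omega>"
  by (simp add: V_def powr_def exp_minus field_simps)

text \<open>\<open>V\<close> will be sampled at values of \<open>\<zeta>\<close>, which may
  coincide; \<open>\<tau>\<close> is therefore not assumed injective.\<close>

lemma Z_self_similar_indexed:
  assumes J: "finite J" and \<tau>: "\<And>j. j \<in> J \<Longrightarrow> 0 \<le> \<tau> j" and c: "0 < c"
  shows "distr MZ (PiM J (\<lambda>_. borel)) (\<lambda>\<omega>. \<lambda>j\<in>J. Z (c * \<tau> j) \<omega>)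
       = distr MZ (PiM J (\<lambda>_. borel)) (\<lambda>\<omega>. \<lambda>j\<in>J. c powr \<kappa> * Z (\<tau> j) \<omega>)"
proof -
  have "distr MZ (PiM (\<tau> ` J) (\<lambda>_. borel)) (\<lambda>\<omega>. \<lambda>x\<in>\<tau> ` J. Z (c * x) \<omega>)
      = distr MZ (PiM (\<tau> ` J) (\<lambda>_. borel)) (\<lambda>\<omega>. \<lambda>x\<in>\<tau> ` J. c powr \<kappa> * Z x \<omega>)"
    using assms by (intro Z_ss[unfolded self_similar_def, rule_format]) auto
  moreover have "(\<lambda>\<omega>. \<lambda>x\<in>\<tau> ` J. Z (c * x) \<omega>) \<in> measurable MZ (PiM (\<tau> ` J) (\<lambda>_. borel))"
      "(\<lambda>\<omega>. \<lambda>x\<in>\<tau> ` J. c powr \<kappa> * Z x \<omega>) \<in> measurable MZ (PiM (\<tau> ` J) (\<lambda>_. borel))"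
    using assms
    by (safe intro!: measurable_restrict borel_measurable_times borel_measurable_const Z_measurable mult_nonneg_nonneg) auto
  ultimately have "distr MZ (PiM J (\<lambda>_. borel)) (\<lambda>\<omega>. \<lambda>j\<in>J. (\<lambda>x\<in>\<tau> ` J. Z (c * x) \<omega>) (\<tau> j))
      = distr MZ (PiM J (\<lambda>_. borel)) (\<lambda>\<omega>. \<lambda>j\<in>J. (\<lambda>x\<in>\<tau> ` J. c powr \<kappa> * Z x \<omega>) (\<tau> j))"
    by (rule distr_eq_compose[OF _ _ _ measurable_reindex])
  then show ?thesis by (simp cong: restrict_cong)
qed

text \<open>A shift by \<open>\<delta>\<close> in logarithmic time is a dilation by
  \<open>exp \<delta>\<close> in real time. The factor \<open>exp \<delta> powr \<kappa>\<close>
  from self-similarity cancels against the prefactor in \<open>V\<close>.\<close>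

lemma V_stationary:
  assumes J: "finite J"
  shows "distr MZ (PiM J (\<lambda>_. borel)) (\<lambda>\<omega>. \<lambda>j\<in>J. V (\<tau> j + \<delta>) \<omega>)
       = distr MZ (PiM J (\<lambda>_. borel)) (\<lambda>\<omega>. \<lambda>j\<in>J. V (\<tau> j) \<omega>)"
proof -
  let ?g = "\<lambda>y. \<lambda>j\<in>J. exp (- \<kappa> * (\<tau> j + \<delta>)) * y j"
  have gm: "?g \<in> measurable (PiM J (\<lambda>_. borel)) (PiM J (\<lambda>_. borel))"
    by (intro measurable_restrict borel_measurable_times borel_measurable_const measurable_component_singleton)
  have "distr MZ (PiM J (\<lambda>_. borel)) (\<lambda>\<omega>. ?g (\<lambda>j\<in>J. Z (exp \<delta> * exp (\<tau> j)) \<omega>))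
      = distr MZ (PiM J (\<lambda>_. borel)) (\<lambda>\<omega>. ?g (\<lambda>j\<in>J. exp \<delta> powr \<kappa> * Z (exp (\<tau> j)) \<omega>))"
    by (rule distr_eq_compose[OF Z_self_similar_indexed _ _ gm])
       (auto simp: J intro!: measurable_restrict borel_measurable_times)
  moreover have "?g (\<lambda>j\<in>J. Z (exp \<delta> * exp (\<tau> j)) \<omega>) = (\<lambda>j\<in>J. V (\<tau> j + \<delta>) \<omega>)" for \<omega>
    by (auto simp: V_def exp_add mult.commute)
  moreover have "?g (\<lambda>j\<in>J. exp \<delta> powr \<kappa> * Z (exp (\<tau> j)) \<omega>) = (\<lambda>j\<in>J. V (\<tau> j) \<omega>)" for \<omega>
    by (intro restrict_ext) (simp add: V_def powr_def distrib_left mult_exp_exp flip: mult.assoc)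
  ultimately show ?thesis by simp
qed

lemma V_stationary_integral:
  fixes f :: "('i \<Rightarrow> real) \<Rightarrow> real"
  assumes J: "finite J" and f: "f \<in> borel_measurable (PiM J (\<lambda>_. borel))"
  shows "(\<integral>\<omega>. f (\<lambda>j\<in>J. V (\<tau> j + \<delta>) \<omega>) \<partial>MZ) = (\<integral>\<omega>. f (\<lambda>j\<in>J. V (\<tau> j) \<omega>) \<partial>MZ)"
proof -
  have m: "(\<lambda>\<omega>. \<lambda>j\<in>J. V (\<tau> j) \<omega>) \<in> measurable MZ (PiM J (\<lambda>_. borel))" for \<tau>
    by (intro measurable_restrict) measurable
  have "(\<integral>\<omega>. f (\<lambda>j\<in>J. V (\<tau> j + \<delta>) \<omega>) \<partial>MZ)
      = (\<integral>y. f y \<partial>distr MZ (PiM J (\<lambda>_. borel)) (\<lambda>\<omega>. \<lambda>j\<in>J. V (\<tau> j + \<delta>) \<omega>))"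
    by (rule integral_distr[OF m f, symmetric])
  also have "\<dots> = (\<integral>\<omega>. f (\<lambda>j\<in>J. V (\<tau> j) \<omega>) \<partial>MZ)"
    unfolding V_stationary[OF J] by (rule integral_distr[OF m f])
  finally show ?thesis .
qed

lemma V_cylinder_in_nat_filtration:
  assumes J: "finite J" and \<tau>: "\<And>j. j \<in> J \<Longrightarrow> \<tau> j \<le> \<beta>" and E: "E \<in> sets (PiM J (\<lambda>_. borel))"
  shows "{\<omega> \<in> space MZ. (\<lambda>j\<in>J. V (\<tau> j) \<omega>) \<in> E} \<in> nat_filtration MZ Z (exp \<beta>)"
proof -
  let ?K = "(\<lambda>j. exp (\<tau> j)) ` J"
  let ?g = "\<lambda>y. \<lambda>j\<in>J. exp (- \<kappa> * \<tau> j) * y (exp (\<tau> j))"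
  let ?F = "?g -` E \<inter> space (PiM ?K (\<lambda>_. borel))"
  have "?g \<in> measurable (PiM ?K (\<lambda>_. borel)) (PiM J (\<lambda>_. borel))"
    by (intro measurable_restrict borel_measurable_times measurable_const measurable_component_singleton) auto
  then have "?F \<in> sets (PiM ?K (\<lambda>_. borel))"
    using E by (rule measurable_sets)
  with J \<tau> have "{\<omega> \<in> space MZ. (\<lambda>t\<in>?K. Z t \<omega>) \<in> ?F} \<in> nat_filtration MZ Z (exp \<beta>)"
    by (intro cylinder_in_nat_filtration) auto
  moreover have "?g (\<lambda>t\<in>?K. Z t \<omega>) = (\<lambda>j\<in>J. V (\<tau> j) \<omega>)" for \<omega>
    by (auto simp: V_def)
  ultimately show ?thesis by (simp add: space_PiM)
qed

lemma Z_markov_set_integral: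
  assumes "0 \<le> s" "s \<le> t" "A \<in> nat_filtration MZ Z s" "B \<in> sets borel"
  shows "(LINT \<omega>:A|MZ. indicator B (Z t \<omega>)) = (LINT \<omega>:A|MZ. measure (P s t (Z s \<omega>)) B)"
  using Z_markov assms measure_Int_vimage_eq_set_integral[of MZ A "Z t" B]
  unfolding markov_process_def by metis

text \<open>Stationarity moves the last time to \<open>ln t\<close>, where \<open>t powr \<kappa> * V (ln t) = Z t\<close>. Applying the Markov
  property of \<open>Z\<close> there and shifting back avoids any almost-everywhere scaling relation between kernels.\<close>

lemma V_markov:
  assumes J: "finite J" "k \<in> J" and \<tau>: "\<And>j. j \<in> J \<Longrightarrow> \<tau> j \<le> \<tau> k" and d: "0 \<le> d" and t: "0 < t"
    and E: "E \<in> sets (PiM J (\<lambda>_. borel))" and B: "B \<in> sets borel"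
  shows "(\<integral>\<omega>. indicator E (\<lambda>j\<in>J. V (\<tau> j) \<omega>) * indicator B (t powr \<kappa> * V (\<tau> k + d) \<omega>) \<partial>MZ)
    = (\<integral>\<omega>. indicator E (\<lambda>j\<in>J. V (\<tau> j) \<omega>) *
        measure (P (t * exp (- d)) t (t powr \<kappa> * exp (- \<kappa> * d) * V (\<tau> k) \<omega>)) B \<partial>MZ)"
    (is "?lhs = ?rhs")
proof -
  \<comment> \<open>With this shift \<open>\<tau> k + d + \<delta> = ln t\<close>, and the present
    \<open>\<tau> k + \<delta>\<close> is the logarithm of the real time
    \<open>s = t * exp (- d)\<close>.\<close>
  define \<delta> where "\<delta> = ln t - (\<tau> k + d)"
  define s where "s = t * exp (- d)"
  have s: "0 < s" "s \<le> t" "ln s = \<tau> k + \<delta>" "s = exp (\<tau> k + \<delta>)"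
  proof -
    show "0 < s" "s \<le> t" using t d by (auto simp: s_def mult_le_cancel_left1)
    show "ln s = \<tau> k + \<delta>" using t by (simp add: s_def \<delta>_def ln_mult)
    with \<open>0 < s\<close> show "s = exp (\<tau> k + \<delta>)" by (metis exp_ln)
  qed
  have E_m [measurable]: "E \<in> sets (PiM J (\<lambda>_. borel))" by fact
  \<comment> \<open>The index \<open>None\<close> stands for the future time. A fresh index keeps
    past and future in one vector even when \<open>\<tau> k + d\<close> equals a past time, so
    stationarity moves both together.\<close>
  let ?L = "insert None (Some ` J)"
  let ?\<tau> = "case_option (\<tau> k + d) \<tau>"
  let ?f = "\<lambda>y. indicator E (\<lambda>j\<in>J. y (Some j)) * indicator B (t powr \<kappa> * y None) :: real"
  have restr: "(\<lambda>y. \<lambda>j\<in>J. y (Some j)) \<in> measurable (PiM ?L (\<lambda>_. borel)) (PiM J (\<lambda>_. borel :: real measure))"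
    by (intro measurable_restrict measurable_component_singleton) auto
  have "?f \<in> borel_measurable (PiM ?L (\<lambda>_. borel))"
    using B by (intro borel_measurable_times measurable_compose[OF restr]
        measurable_compose[OF measurable_component_singleton[of None], where g = "\<lambda>x. indicator B (t powr \<kappa> * x)"])
      auto
  from V_stationary_integral[OF _ this, of ?\<tau> \<delta>] J(1)
  have "?lhs = (\<integral>\<omega>. indicator E (\<lambda>j\<in>J. V (\<tau> j + \<delta>) \<omega>) * indicator B (Z t \<omega>) \<partial>MZ)"
    using t by (simp add: Z_eq_V \<delta>_def cong: restrict_cong)
  also have "\<dots> = (LINT \<omega>:{\<omega>\<in>space MZ. (\<lambda>j\<in>J. V (\<tau> j + \<delta>) \<omega>) \<in> E}|MZ. indicator B (Z t \<omega>))"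
    unfolding set_lebesgue_integral_def
    by (intro Bochner_Integration.integral_cong) (auto simp: indicator_def)
  also have "\<dots> = (LINT \<omega>:{\<omega>\<in>space MZ. (\<lambda>j\<in>J. V (\<tau> j + \<delta>) \<omega>) \<in> E}|MZ. measure (P s t (Z s \<omega>)) B)"
    using s \<tau> B E J(1) V_cylinder_in_nat_filtration[of J "\<lambda>j. \<tau> j + \<delta>" "\<tau> k + \<delta>" E]
    by (intro Z_markov_set_integral) auto
  also have "\<dots> = (\<integral>\<omega>. indicator E (\<lambda>j\<in>J. V (\<tau> j + \<delta>) \<omega>) *
      measure (P s t (t powr \<kappa> * exp (- \<kappa> * d) * V (\<tau> k + \<delta>) \<omega>)) B \<partial>MZ)"
  proof -
    \<comment> \<open>This makes the argument of the kernel exactly \<open>Z s\<close>.\<close>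
    have "s powr \<kappa> = t powr \<kappa> * exp (- \<kappa> * d)"
      using t by (simp add: s_def powr_mult) (simp add: powr_def)
    then show ?thesis
      unfolding set_lebesgue_integral_def
      by (intro Bochner_Integration.integral_cong) (auto simp: indicator_def Z_eq_V s)
  qed
  also have "\<dots> = ?rhs"
  proof -
    \<comment> \<open>Only past and present are left in the integrand, so the shift back is
      stationarity over \<open>J\<close> alone.\<close>
    let ?h = "\<lambda>y. indicator E y * measure (P s t (t powr \<kappa> * exp (- \<kappa> * d) * y k)) B"
    have Pm: "(\<lambda>x. measure (P s t x) B) \<in> borel_measurable borel"
      using Z_markov s B by (auto simp: markov_process_def markov_kernels_def)
    have "(\<lambda>y. t powr \<kappa> * exp (- \<kappa> * d) * y k) \<in> borel_measurable (PiM J (\<lambda>_. borel))"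
      using J(2) by (intro borel_measurable_times borel_measurable_const measurable_component_singleton)
    from measurable_compose[OF this Pm] have "?h \<in> borel_measurable (PiM J (\<lambda>_. borel))"
      by (intro borel_measurable_times borel_measurable_indicator E)
    from V_stationary_integral[OF J(1) this, of \<tau> \<delta>] J(2) show ?thesis
      by (simp add: s_def)
  qed
  finally show ?thesis .
qed

text \<open>Since \<open>V b\<close> is \<open>exp (- \<kappa> * b)\<close> times the martingale
  value \<open>Z (exp b)\<close>, moving \<open>d\<close> further costs exactly the deterministic
  factor \<open>exp (- \<kappa> * d)\<close>.\<close>

lemma V_martingale:
  assumes mart: "martingale MZ Z"
    and J: "finite J" "k \<in> J" and \<tau>: "\<And>j. j \<in> J \<Longrightarrow> \<tau> j \<le> \<tau> k" and d: "0 \<le> d"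
    and E: "E \<in> sets (PiM J (\<lambda>_. borel))"
  shows "(\<integral>\<omega>. indicator E (\<lambda>j\<in>J. V (\<tau> j) \<omega>) * V (\<tau> k + d) \<omega> \<partial>MZ)
    = exp (- \<kappa> * d) * (\<integral>\<omega>. indicator E (\<lambda>j\<in>J. V (\<tau> j) \<omega>) * V (\<tau> k) \<omega> \<partial>MZ)"
proof -
  let ?A = "{\<omega> \<in> space MZ. (\<lambda>j\<in>J. V (\<tau> j) \<omega>) \<in> E}"
  have *: "(\<integral>\<omega>. indicator E (\<lambda>j\<in>J. V (\<tau> j) \<omega>) * V b \<omega> \<partial>MZ) = exp (- \<kappa> * b) * (LINT \<omega>:?A|MZ. Z (exp b) \<omega>)" for b
    unfolding set_lebesgue_integral_def V_def integral_mult_right_zero[symmetric]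
    by (intro Bochner_Integration.integral_cong) (auto simp: indicator_def)
  have "(LINT \<omega>:?A|MZ. Z (exp (\<tau> k + d)) \<omega>) = (LINT \<omega>:?A|MZ. Z (exp (\<tau> k)) \<omega>)"
    using mart d V_cylinder_in_nat_filtration[OF J(1) \<tau> E] unfolding martingale_def by simp
  then show ?thesis
    unfolding * by (simp add: distrib_left mult_exp_exp add.commute flip: mult.assoc)
qed

lemma V_identically_distributed:
  fixes f :: "real \<Rightarrow> real"
  assumes "f \<in> borel_measurable borel"
  shows "(\<integral>\<omega>. f (V b \<omega>) \<partial>MZ) = (\<integral>\<omega>. f (V 0 \<omega>) \<partial>MZ)"
  using V_stationary_integral[of "{()}" "\<lambda>y. f (y ())" "\<lambda>_. 0" b] assms by simp


section \<open>The subordinated process\<close>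

sublocale Q: pair_prob_space N MZ ..

text \<open>Truncating \<open>ln t - a\<close> at 0 (and setting it to 0 at \<open>t \<le> 0\<close>) keeps every \<open>\<zeta> (lag a t)\<close> measurable and the
  lags monotone in \<open>t\<close>. At \<open>t = 0\<close> the factor \<open>0 powr \<kappa> = 0\<close> makes the choice irrelevant.\<close>

definition lag :: "real \<Rightarrow> real \<Rightarrow> real" where
  "lag a t = (if t \<le> 0 then 0 else max 0 (ln t - a))"

definition Y :: "real \<Rightarrow> real \<Rightarrow> 'b \<times> 'a \<Rightarrow> real" where
  "Y a t = (\<lambda>(\<eta>, \<omega>). t powr \<kappa> * V (\<zeta> (lag a t) \<eta>) \<omega>)"

lemma lag_nonneg: "0 \<le> lag a t"
  by (simp add: lag_def)

lemma lag_mono: "s \<le> t \<Longrightarrow> lag a s \<le> lag a t"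
proof (cases "s \<le> 0")
  case False
  assume "s \<le> t"
  with False have "ln s \<le> ln t" by (subst ln_le_cancel_iff) auto
  with False \<open>s \<le> t\<close> show ?thesis by (simp add: lag_def max_def del: ln_le_cancel_iff)
qed (simp add: lag_def)

lemma Y_0: "Y a 0 p = 0"
  by (simp add: Y_def split_beta')

lemma Y_measurable [measurable]: "Y a t \<in> borel_measurable (N \<Otimes>\<^sub>M MZ)"
proof -
  have [measurable]: "\<zeta> (lag a t) \<in> borel_measurable N"
    by (intro zeta_measurable lag_nonneg)
  show ?thesis unfolding Y_def by measurable
qed

lemma Y_restrict_measurable: "(\<lambda>p. \<lambda>t\<in>J. Y a t p) \<in> measurable (N \<Otimes>\<^sub>M MZ) (PiM J (\<lambda>_. borel))"
  by (intro measurable_restrict Y_measurable)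

lemma V_vector_measurable:
  "(\<lambda>(y, \<omega>). \<lambda>j\<in>J. w j * V (y j) \<omega>) \<in> measurable (PiM J (\<lambda>_. borel) \<Otimes>\<^sub>M MZ) (PiM J (\<lambda>_. borel))"
  unfolding split_beta'
  by (intro measurable_restrict borel_measurable_times borel_measurable_const V_measurable_compose
      measurable_snd measurable_compose[OF measurable_fst measurable_component_singleton])

lemma V_vector_measurable2:
  "(\<lambda>\<omega>. \<lambda>j\<in>J. w j * V (y j) \<omega>) \<in> measurable MZ (PiM J (\<lambda>_. borel))"
  by (intro measurable_restrict borel_measurable_times borel_measurable_const V_measurable_compose
      measurable_ident_sets[OF refl])

lemma V_vector_stationary:
  assumes "finite J"
  shows "distr MZ (PiM J (\<lambda>_. borel)) (\<lambda>\<omega>. \<lambda>j\<in>J. w j * V (y j + \<delta>) \<omega>)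
       = distr MZ (PiM J (\<lambda>_. borel)) (\<lambda>\<omega>. \<lambda>j\<in>J. w j * V (y j) \<omega>)"
proof -
  have g: "(\<lambda>x. \<lambda>j\<in>J. w j * x j) \<in> measurable (PiM J (\<lambda>_. borel)) (PiM J (\<lambda>_. borel :: real measure))"
    by (intro measurable_restrict borel_measurable_times borel_measurable_const measurable_component_singleton)
  have m: "(\<lambda>\<omega>. \<lambda>j\<in>J. V (y j) \<omega>) \<in> measurable MZ (PiM J (\<lambda>_. borel))" for y
    by (intro measurable_restrict V_measurable_compose borel_measurable_const measurable_ident_sets[OF refl])
  have "distr MZ (PiM J (\<lambda>_. borel)) (\<lambda>\<omega>. \<lambda>j\<in>J. w j * (\<lambda>j\<in>J. V (y j + \<delta>) \<omega>) j)
      = distr MZ (PiM J (\<lambda>_. borel)) (\<lambda>\<omega>. \<lambda>j\<in>J. w j * (\<lambda>j\<in>J. V (y j) \<omega>) j)"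
    by (rule distr_eq_compose[OF V_stationary[OF assms] m m g])
  then show ?thesis by (simp cong: restrict_cong)
qed

section \<open>Laws of \<open>V\<close> sampled at independent random positions\<close>

text \<open>The positions live on the factor \<open>N\<close> and are thus independent of
  \<open>V\<close>. Separating them from the deterministic weights lets two invariances act one at a
  time: replacing the positions by others of equal law, and shifting them all by a common random
  amount.\<close>

definition mix :: "'i set \<Rightarrow> ('i \<Rightarrow> real) \<Rightarrow> ('b \<Rightarrow> 'i \<Rightarrow> real) \<Rightarrow> ('i \<Rightarrow> real) measure" where
  "mix J w \<xi> = distr (N \<Otimes>\<^sub>M MZ) (PiM J (\<lambda>_. borel)) (\<lambda>(\<eta>, \<omega>). \<lambda>j\<in>J. w j * V (\<xi> \<eta> j) \<omega>)"

lemma mix_measurable: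
  assumes "\<xi> \<in> measurable N (PiM J (\<lambda>_. borel))"
  shows "(\<lambda>(\<eta>, \<omega>). \<lambda>j\<in>J. w j * V (\<xi> \<eta> j) \<omega>) \<in> measurable (N \<Otimes>\<^sub>M MZ) (PiM J (\<lambda>_. borel))"
proof -
  have "(\<lambda>(\<eta>, \<omega>). (\<xi> \<eta>, \<omega>)) \<in> measurable (N \<Otimes>\<^sub>M MZ) (PiM J (\<lambda>_. borel) \<Otimes>\<^sub>M MZ)"
    unfolding split_beta' by (intro measurable_Pair measurable_compose[OF measurable_fst assms] measurable_snd)
  from measurable_compose[OF this V_vector_measurable] show ?thesis by (simp add: split_beta')
qed

lemma emeasure_mix:
  assumes \<xi>: "\<xi> \<in> measurable N (PiM J (\<lambda>_. borel))" and E: "E \<in> sets (PiM J (\<lambda>_. borel))"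
  shows "emeasure (mix J w \<xi>) E =
    (\<integral>\<^sup>+\<eta>. emeasure (distr MZ (PiM J (\<lambda>_. borel)) (\<lambda>\<omega>. \<lambda>j\<in>J. w j * V (\<xi> \<eta> j) \<omega>)) E \<partial>N)"
proof -
  let ?f = "\<lambda>(\<eta>, \<omega>). \<lambda>j\<in>J. w j * V (\<xi> \<eta> j) \<omega>"
  have "emeasure (mix J w \<xi>) E = emeasure (N \<Otimes>\<^sub>M MZ) (?f -` E \<inter> space (N \<Otimes>\<^sub>M MZ))"
    unfolding mix_def by (rule emeasure_distr[OF mix_measurable[OF \<xi>] E])
  also have "\<dots> = (\<integral>\<^sup>+\<eta>. emeasure MZ (Pair \<eta> -` (?f -` E \<inter> space (N \<Otimes>\<^sub>M MZ))) \<partial>N)"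
    by (rule MZ.emeasure_pair_measure_alt[OF measurable_sets[OF mix_measurable[OF \<xi>] E]])
  also have "\<dots> = (\<integral>\<^sup>+\<eta>. emeasure (distr MZ (PiM J (\<lambda>_. borel)) (\<lambda>\<omega>. \<lambda>j\<in>J. w j * V (\<xi> \<eta> j) \<omega>)) E \<partial>N)"
    by (intro nn_integral_cong)
       (auto simp: emeasure_distr[OF V_vector_measurable2 E] space_pair_measure intro!: arg_cong[where f="emeasure MZ"])
  finally show ?thesis .
qed

text \<open>By \<open>emeasure_mix\<close> the mass of \<open>E\<close> is the mean of a fixed
  function \<open>?F\<close> of the positions. Measurability of \<open>?F\<close> is that of section
  measures of a set in the product space.\<close>

lemma mix_cong_distr:
  assumes \<xi>: "\<xi> \<in> measurable N (PiM J (\<lambda>_. borel))" and \<xi>': "\<xi>' \<in> measurable N (PiM J (\<lambda>_. borel))"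
    and eq: "distr N (PiM J (\<lambda>_. borel)) \<xi> = distr N (PiM J (\<lambda>_. borel)) \<xi>'"
  shows "mix J w \<xi> = mix J w \<xi>'"
proof (rule measure_eqI)
  fix E assume "E \<in> sets (mix J w \<xi>)"
  then have E: "E \<in> sets (PiM J (\<lambda>_. borel))" by (simp add: mix_def)
  let ?W = "\<lambda>(y, \<omega>). \<lambda>j\<in>J. w j * V (y j) \<omega>"
  let ?F = "\<lambda>y. emeasure (distr MZ (PiM J (\<lambda>_. borel)) (\<lambda>\<omega>. \<lambda>j\<in>J. w j * V (y j) \<omega>)) E"
  let ?S = "?W -` E \<inter> space (PiM J (\<lambda>_. borel :: real measure) \<Otimes>\<^sub>M MZ)"
  have "(\<lambda>y. emeasure MZ (Pair y -` ?S)) \<in> borel_measurable (PiM J (\<lambda>_. borel))"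
    by (rule MZ.measurable_emeasure_Pair[OF measurable_sets[OF V_vector_measurable E]])
  moreover have "emeasure MZ (Pair y -` ?S) = ?F y" if "y \<in> space (PiM J (\<lambda>_. borel))" for y
    using that unfolding emeasure_distr[OF V_vector_measurable2 E]
    by (intro arg_cong[where f="emeasure MZ"]) (auto simp: space_pair_measure)
  ultimately have F: "?F \<in> borel_measurable (PiM J (\<lambda>_. borel))"
    by (simp cong: measurable_cong)
  have "emeasure (mix J w \<xi>) E = (\<integral>\<^sup>+y. ?F y \<partial>distr N (PiM J (\<lambda>_. borel)) \<xi>)"
    using emeasure_mix[OF \<xi> E] nn_integral_distr[OF \<xi>, of ?F] F by simp
  also have "\<dots> = emeasure (mix J w \<xi>') E"
    unfolding eq using emeasure_mix[OF \<xi>' E] nn_integral_distr[OF \<xi>', of ?F] F by simp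
  finally show "emeasure (mix J w \<xi>) E = emeasure (mix J w \<xi>') E" .
qed (simp add: mix_def)

text \<open>For each fixed \<eta> the shift is a constant, so stationarity of \<open>V\<close>
  applies inside the integral over \<open>N\<close>. The shift may therefore depend on the positions
  themselves.\<close>

lemma mix_shift:
  assumes J: "finite J" and \<xi>: "\<xi> \<in> measurable N (PiM J (\<lambda>_. borel))" and v: "v \<in> borel_measurable N"
  shows "mix J w \<xi> = mix J w (\<lambda>\<eta>. \<lambda>j\<in>J. \<xi> \<eta> j - v \<eta>)"
proof (rule measure_eqI)
  fix E assume "E \<in> sets (mix J w \<xi>)"
  then have E: "E \<in> sets (PiM J (\<lambda>_. borel))" by (simp add: mix_def)
  have \<xi>': "(\<lambda>\<eta>. \<lambda>j\<in>J. \<xi> \<eta> j - v \<eta>) \<in> measurable N (PiM J (\<lambda>_. borel))"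
    by (intro measurable_restrict borel_measurable_diff v measurable_compose[OF \<xi> measurable_component_singleton])
  have "distr MZ (PiM J (\<lambda>_. borel)) (\<lambda>\<omega>. \<lambda>j\<in>J. w j * V (\<xi> \<eta> j) \<omega>)
      = distr MZ (PiM J (\<lambda>_. borel)) (\<lambda>\<omega>. \<lambda>j\<in>J. w j * V ((\<lambda>j\<in>J. \<xi> \<eta> j - v \<eta>) j) \<omega>)" for \<eta>
    using V_vector_stationary[OF J, of w "\<lambda>j. \<xi> \<eta> j - v \<eta>" "v \<eta>"] by (simp cong: restrict_cong)
  then show "emeasure (mix J w \<xi>) E = emeasure (mix J w (\<lambda>\<eta>. \<lambda>j\<in>J. \<xi> \<eta> j - v \<eta>)) E"
    unfolding emeasure_mix[OF \<xi> E] emeasure_mix[OF \<xi>' E] by simp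
qed (simp add: mix_def)

text \<open>Time 0 is exempt because its weight \<open>0 powr \<kappa>\<close> vanishes, whatever
  the position. This matters when the start is moved, since \<open>lag a 0\<close> stays 0 while the
  other lags are translated.\<close>

lemma distr_Y_mix:
  assumes "\<And>t. t \<in> J \<Longrightarrow> t \<noteq> 0 \<Longrightarrow> lag a t = l t"
  shows "distr (N \<Otimes>\<^sub>M MZ) (PiM J (\<lambda>_. borel)) (\<lambda>p. \<lambda>t\<in>J. Y a t p)
       = mix J (\<lambda>t. t powr \<kappa>) (\<lambda>\<eta>. \<lambda>t\<in>J. \<zeta> (l t) \<eta>)"
  unfolding mix_def
proof (intro distr_cong refl)
  fix p
  show "(\<lambda>t\<in>J. Y a t p) = (case p of (\<eta>, \<omega>) \<Rightarrow> \<lambda>j\<in>J. j powr \<kappa> * V ((\<lambda>t\<in>J. \<zeta> (l t) \<eta>) j) \<omega>)"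
    unfolding split_beta'
  proof (rule restrict_ext)
    fix t assume "t \<in> J"
    then show "Y a t p = t powr \<kappa> * V ((\<lambda>t\<in>J. \<zeta> (l t) (fst p)) t) (snd p)"
      using assms[of t] by (cases "t = 0") (auto simp: Y_def split_beta')
  qed
qed

text \<open>Starting earlier by \<open>v = b - a\<close> puts the positions at
  \<open>\<zeta> (v + lag b t)\<close>. Stationarity of \<open>V\<close> subtracts
  \<open>\<zeta> v\<close>, and stationary independent increments of \<open>\<zeta>\<close> then
  give back the positions for start \<open>b\<close>.\<close>

lemma distr_Y_shift:
  assumes J: "finite J" "J \<subseteq> {0..}" and a: "a \<le> b" "\<And>t. t \<in> J \<Longrightarrow> 0 < t \<Longrightarrow> b \<le> ln t"
  shows "distr (N \<Otimes>\<^sub>M MZ) (PiM J (\<lambda>_. borel)) (\<lambda>p. \<lambda>t\<in>J. Y a t p)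
       = distr (N \<Otimes>\<^sub>M MZ) (PiM J (\<lambda>_. borel)) (\<lambda>p. \<lambda>t\<in>J. Y b t p)"
proof -
  let ?w = "\<lambda>t. t powr \<kappa>"
  define v where "v = b - a"
  have v: "0 \<le> v" using a by (simp add: v_def)
  have m: "(\<lambda>\<eta>. \<lambda>t\<in>J. \<zeta> (c + lag b t) \<eta>) \<in> measurable N (PiM J (\<lambda>_. borel))" if "0 \<le> c" for c
    using that by (intro measurable_restrict zeta_measurable add_nonneg_nonneg lag_nonneg)
  have m0: "(\<lambda>\<eta>. \<lambda>t\<in>J. \<zeta> (lag b t) \<eta>) \<in> measurable N (PiM J (\<lambda>_. borel))"
    using m[of 0] by simp
  have vm: "\<zeta> v \<in> borel_measurable N" using v by simp
  have md: "(\<lambda>\<eta>. \<lambda>t\<in>J. \<zeta> (v + lag b t) \<eta> - \<zeta> v \<eta>) \<in> measurable N (PiM J (\<lambda>_. borel))"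
    using v by (intro measurable_restrict borel_measurable_diff vm zeta_measurable add_nonneg_nonneg lag_nonneg)
  have "distr (N \<Otimes>\<^sub>M MZ) (PiM J (\<lambda>_. borel)) (\<lambda>p. \<lambda>t\<in>J. Y a t p)
      = mix J ?w (\<lambda>\<eta>. \<lambda>t\<in>J. \<zeta> (v + lag b t) \<eta>)"
  proof (rule distr_Y_mix)
    fix t assume "t \<in> J" "t \<noteq> 0"
    with J have "0 < t" by force
    with a(2)[OF \<open>t \<in> J\<close>] a(1) show "lag a t = v + lag b t"
      by (simp add: lag_def v_def)
  qed
  also have "\<dots> = mix J ?w (\<lambda>\<eta>. \<lambda>t\<in>J. (\<lambda>t\<in>J. \<zeta> (v + lag b t) \<eta>) t - \<zeta> v \<eta>)"
    by (rule mix_shift[OF J(1) m[OF v] vm])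
  also have "\<dots> = mix J ?w (\<lambda>\<eta>. \<lambda>t\<in>J. \<zeta> (v + lag b t) \<eta> - \<zeta> v \<eta>)"
    by (simp cong: restrict_cong)
  also have "\<dots> = mix J ?w (\<lambda>\<eta>. \<lambda>t\<in>J. \<zeta> (lag b t) \<eta>)"
    by (rule mix_cong_distr[OF md m0 distr_zeta_shift_indexed[OF J(1) lag_nonneg v]])
  also have "\<dots> = distr (N \<Otimes>\<^sub>M MZ) (PiM J (\<lambda>_. borel)) (\<lambda>p. \<lambda>t\<in>J. Y b t p)"
    by (rule distr_Y_mix[symmetric]) simp
  finally show ?thesis .
qed

text \<open>If \<open>J - {0}\<close> is empty, \<open>base J\<close> is a junk value, which is harmless because then \<open>Y a t = 0\<close> on \<open>J\<close>.\<close>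

definition base :: "real set \<Rightarrow> real" where
  "base J = ln (Min (J - {0}))"

lemma base_le: "finite J \<Longrightarrow> J \<subseteq> {0..} \<Longrightarrow> t \<in> J \<Longrightarrow> 0 < t \<Longrightarrow> base J \<le> ln t"
proof -
  assume J: "finite J" "J \<subseteq> {0..}" "t \<in> J" "0 < t"
  then have "Min (J - {0}) \<in> J - {0}" by (intro Min_in) auto
  with J(2) have "0 < Min (J - {0})" by force
  moreover have "Min (J - {0}) \<le> t" using J by auto
  ultimately show ?thesis using J(4) by (simp add: base_def)
qed

section \<open>Consistency of the finite-dimensional laws and the Kolmogorov limit\<close>

definition fdd :: "real set \<Rightarrow> (real \<Rightarrow> real) measure" where
  "fdd J = distr (N \<Otimes>\<^sub>M MZ) (PiM J (\<lambda>_. borel)) (\<lambda>p. \<lambda>t\<in>J. Y (base J) t p)"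

lemma fdd_eq:
  assumes J: "finite J" "J \<subseteq> {0..}" and a: "\<And>t. t \<in> J \<Longrightarrow> 0 < t \<Longrightarrow> a \<le> ln t"
  shows "fdd J = distr (N \<Otimes>\<^sub>M MZ) (PiM J (\<lambda>_. borel)) (\<lambda>p. \<lambda>t\<in>J. Y a t p)"
proof (cases "a \<le> base J")
  case True
  then show ?thesis
    unfolding fdd_def by (intro distr_Y_shift[symmetric] J base_le)
next
  case False
  then show ?thesis
    unfolding fdd_def by (intro distr_Y_shift J a) auto
qed

sublocale KL: polish_projective "{0..}" fdd
  unfolding polish_projective_def
proof (rule projective_family.intro)
  fix J H :: "real set" assume H: "J \<subseteq> H" "finite H" "H \<subseteq> {0..}"
  have r: "(\<lambda>f. restrict f J) \<in> measurable (PiM H (\<lambda>_. borel)) (PiM J (\<lambda>_. borel :: real measure))"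
    using H(1) by (intro measurable_restrict_subset)
  have "distr (fdd H) (PiM J (\<lambda>_. borel)) (\<lambda>f. restrict f J)
      = distr (N \<Otimes>\<^sub>M MZ) (PiM J (\<lambda>_. borel)) (\<lambda>p. \<lambda>t\<in>J. Y (base H) t p)"
    unfolding fdd_def using H(1)
    by (subst distr_distr[OF r Y_restrict_measurable]) (simp add: comp_def restrict_restrict Int_absorb1)
  \<comment> \<open>Restricting to \<open>J\<close> leaves a process started at
    \<open>base H\<close>, in general below \<open>base J\<close>; freedom in the choice of start
    makes the laws agree.\<close>
  also have "\<dots> = fdd J"
    using H by (intro fdd_eq[symmetric] base_le) (auto intro: finite_subset)
  finally show "fdd J = distr (fdd H) (PiM J (\<lambda>_. borel)) (\<lambda>f. restrict f J)" by simp
next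
  fix J :: "real set" assume "finite J" "J \<subseteq> {0..}"
  show "prob_space (fdd J)"
    unfolding fdd_def by (intro Q.P.prob_space_distr Y_restrict_measurable)
qed

text \<open>In the limit space the coordinate at 0 vanishes only almost surely. It is overwritten
  because \<open>X 0 = 0\<close> is claimed for every outcome.\<close>

definition X :: "real \<Rightarrow> (real \<Rightarrow> real) \<Rightarrow> real" where
  "X t \<omega> = (if t = 0 then 0 else \<omega> t)"

lemma X_measurable: "0 \<le> t \<Longrightarrow> X t \<in> borel_measurable KL.lim"
proof (cases "t = 0")
  case False
  assume "0 \<le> t"
  then have "(\<lambda>\<omega>. \<omega> t) \<in> borel_measurable (PiM {0..} (\<lambda>_. borel :: real measure))"
    by (intro measurable_component_singleton) simp
  then show ?thesis
    using False unfolding X_def by (simp cong: measurable_cong_sets)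
qed (simp add: X_def[abs_def])

lemma X_restrict_measurable:
  "J \<subseteq> {0..} \<Longrightarrow> (\<lambda>\<omega>. \<lambda>t\<in>J. X t \<omega>) \<in> measurable KL.lim (PiM J (\<lambda>_. borel))"
  by (intro measurable_restrict X_measurable) auto

lemma distr_X:
  assumes J: "finite J" "J \<subseteq> {0..}" and a: "\<And>t. t \<in> J \<Longrightarrow> 0 < t \<Longrightarrow> a \<le> ln t"
  shows "distr KL.lim (PiM J (\<lambda>_. borel)) (\<lambda>\<omega>. \<lambda>t\<in>J. X t \<omega>)
       = distr (N \<Otimes>\<^sub>M MZ) (PiM J (\<lambda>_. borel)) (\<lambda>p. \<lambda>t\<in>J. Y a t p)"
proof -
  have r: "(\<lambda>f. restrict f J) \<in> measurable KL.lim (PiM J (\<lambda>_. borel))"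
    using measurable_restrict_subset[OF J(2), of "\<lambda>_. borel :: real measure"] by (simp cong: measurable_cong_sets)
  have eq: "distr KL.lim (PiM J (\<lambda>_. borel)) (\<lambda>f. restrict f J) = fdd J"
  proof (rule measure_eqI)
    fix E assume "E \<in> sets (distr KL.lim (PiM J (\<lambda>_. borel)) (\<lambda>f. restrict f J))"
    then have E: "E \<in> sets (PiM J (\<lambda>_. borel))" by simp
    have "emeasure (distr KL.lim (PiM J (\<lambda>_. borel)) (\<lambda>f. restrict f J)) E
        = emeasure KL.lim ((\<lambda>f. restrict f J) -` E \<inter> space KL.lim)"
      by (rule emeasure_distr[OF r E])
    also have "(\<lambda>f. restrict f J) -` E \<inter> space KL.lim = KL.emb {0..} J E"
      by (simp add: prod_emb_def space_PiM)
    finally show "emeasure (distr KL.lim (PiM J (\<lambda>_. borel)) (\<lambda>f. restrict f J)) E = emeasure (fdd J) E"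
      using KL.emeasure_lim_emb[OF J(2,1) E] by (rule trans)
  qed (simp add: KL.sets_P J)
  \<comment> \<open>Setting the coordinate at 0 to zero turns the canonical process into
    \<open>X\<close> and does not change \<open>Y\<close>, which already vanishes there.\<close>
  let ?g = "\<lambda>y. \<lambda>t\<in>J. if t = 0 then 0 else y t :: real"
  have gm: "?g \<in> measurable (PiM J (\<lambda>_. borel)) (PiM J (\<lambda>_. borel))"
    by (intro measurable_restrict) auto
  have "distr KL.lim (PiM J (\<lambda>_. borel)) (\<lambda>\<omega>. ?g (restrict \<omega> J))
      = distr (N \<Otimes>\<^sub>M MZ) (PiM J (\<lambda>_. borel)) (\<lambda>p. ?g (\<lambda>t\<in>J. Y a t p))"
    using eq fdd_eq[OF J a] by (intro distr_eq_compose[OF _ r Y_restrict_measurable gm]) simp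
  moreover have "?g (restrict \<omega> J) = (\<lambda>t\<in>J. X t \<omega>)" for \<omega>
    by (intro restrict_ext) (simp add: X_def)
  moreover have "?g (\<lambda>t\<in>J. Y a t p) = (\<lambda>t\<in>J. Y a t p)" for p
    by (intro restrict_ext) (simp add: Y_0)
  ultimately show ?thesis by simp
qed


section \<open>The transition function\<close>

lemma P_prob_space: "0 \<le> r \<Longrightarrow> r \<le> t \<Longrightarrow> prob_space (P r t x)"
  and P_sets: "0 \<le> r \<Longrightarrow> r \<le> t \<Longrightarrow> sets (P r t x) = sets borel"
  using Z_markov by (auto simp: markov_process_def markov_kernels_def)

text \<open>Measurability of \<open>P r t x\<close> in \<open>(r, x)\<close> is given only for
  \<open>r\<close> in \<open>{0..t}\<close>. Clamping extends it to all of the plane and changes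
  nothing where \<open>r\<close> lies in the interval, hence nothing at \<open>r = R * t\<close>
  almost surely.\<close>

abbreviation clamp :: "real \<Rightarrow> real \<Rightarrow> real" where
  "clamp t r \<equiv> max 0 (min r t)"

lemma P_clamp_measurable:
  assumes t: "0 \<le> t" and B: "B \<in> sets borel"
  shows "(\<lambda>(r, x). measure (P (clamp t r) t x) B) \<in> borel_measurable (borel \<Otimes>\<^sub>M borel)"
proof -
  have "(\<lambda>(r, x). (clamp t r, x)) \<in> measurable (borel \<Otimes>\<^sub>M borel)
      (restrict_space (borel \<Otimes>\<^sub>M borel) ({0..t} \<times> (UNIV :: real set)))"
    using t by (intro measurable_restrict_space2) auto
  moreover have "(\<lambda>(r, x). measure (P r t x) B)
      \<in> borel_measurable (restrict_space (borel \<Otimes>\<^sub>M borel) ({0..t} \<times> UNIV))"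
    using P_joint t B by (simp add: jointly_measurable_kernels_def)
  ultimately have "(\<lambda>p. (\<lambda>(r, x). measure (P r t x) B) ((\<lambda>(r, x). (clamp t r, x)) p)) \<in> borel_measurable (borel \<Otimes>\<^sub>M borel)"
    by (rule measurable_compose)
  then show ?thesis by (simp add: split_beta')
qed

text \<open>The integrand of the new transition function in the variable \<open>d = - ln R\<close>,
  which is the increment of the subordinator.\<close>

definition kern :: "real \<Rightarrow> real \<Rightarrow> real set \<Rightarrow> real \<Rightarrow> real \<Rightarrow> real" where
  "kern s t B d x = measure (P (clamp t (t * exp (- d))) t ((t / s) powr \<kappa> * exp (- \<kappa> * d) * x)) B"

lemma kern_measurable:
  assumes "0 \<le> t" "B \<in> sets borel"
  shows "(\<lambda>(d, x). kern s t B d x) \<in> borel_measurable (borel \<Otimes>\<^sub>M borel)"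
proof -
  have "(\<lambda>(d, x). (t * exp (- d), (t / s) powr \<kappa> * exp (- \<kappa> * d) * x)) \<in> measurable (borel \<Otimes>\<^sub>M borel) (borel \<Otimes>\<^sub>M borel)"
    by measurable
  from measurable_compose[OF this P_clamp_measurable[OF assms]] show ?thesis
    by (simp add: kern_def split_beta')
qed

lemma kern_measurable_compose:
  assumes "0 \<le> t" "B \<in> sets borel" "f \<in> borel_measurable M" "g \<in> borel_measurable M"
  shows "(\<lambda>x. kern s t B (f x) (g x)) \<in> borel_measurable M"
  using measurable_compose[OF measurable_Pair[OF assms(3,4)] kern_measurable[OF assms(1,2)]] by simp

lemma kern_nonneg: "0 \<le> kern s t B d x"
  by (simp add: kern_def)

lemma kern_le_1: "0 \<le> t \<Longrightarrow> kern s t B d x \<le> 1"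
  unfolding kern_def by (intro prob_space.prob_le_1 P_prob_space) auto

text \<open>A \<open>measure_of\<close> has the prescribed values only once the set function is
  known to be countably additive. Identifying it with a bind of probability kernels supplies this,
  together with total mass 1.\<close>

lemma ss_transition_eq_bind:
  assumes st: "0 < s" "s \<le> t"
  defines "k \<equiv> \<lambda>x r. P (clamp t (r * t)) t ((t / s) powr \<kappa> * r powr \<kappa> * x)"
  shows "k x \<in> measurable borel (subprob_algebra borel)" (is ?km)
    and "prob_space (R_law N \<zeta> (t / s))" (is ?prob)
    and "ss_transition \<kappa> P (R_law N \<zeta>) s t x = R_law N \<zeta> (t / s) \<bind> k x" (is ?eq)
proof -
  have t: "0 \<le> t" using st by simp
  have kp: "prob_space (k x r)" and ks: "sets (k x r) = sets borel" for r
    unfolding k_def using t by (auto intro!: P_prob_space P_sets)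
  show km: ?km
  proof (rule measurable_subprob_algebra)
    fix A :: "real set" assume A: "A \<in> sets borel"
    have "(\<lambda>r. (r * t, (t / s) powr \<kappa> * r powr \<kappa> * x)) \<in> measurable borel (borel \<Otimes>\<^sub>M borel)"
      by measurable
    from measurable_compose[OF this P_clamp_measurable[OF t A]]
    have "(\<lambda>r. measure (k x r) A) \<in> borel_measurable borel" by (simp add: k_def)
    moreover have "emeasure (k x r) A = ennreal (measure (k x r) A)" for r
      using kp[of r] by (simp add: prob_space_def finite_measure.emeasure_eq_measure)
    ultimately show "(\<lambda>r. emeasure (k x r) A) \<in> borel_measurable borel" by simp
  qed (auto simp: ks kp prob_space_imp_subprob_space)
  let ?h = "ln (t / s)"
  let ?G = "R_law N \<zeta> (t / s)"
  have h: "0 \<le> ?h" using st by simp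
  have Rm: "(\<lambda>\<eta>. exp (- \<zeta> ?h \<eta>)) \<in> borel_measurable N"
    using zeta_measurable[OF h] by measurable
  show ?prob unfolding R_law_def by (rule N.prob_space_distr[OF Rm])
  then interpret G: prob_space ?G .
  have Gs: "sets ?G = sets borel" by (simp add: R_law_def)
  \<comment> \<open>Nonnegativity of the subordinator puts \<open>R\<close> in the half-open
    interval from 0 to 1, where clamping is the identity.\<close>
  have "AE r in ?G. 0 < r \<and> r \<le> 1"
    unfolding R_law_def using zeta_nonneg[OF h] by (subst AE_distr_iff[OF Rm]) auto
  then have eq: "(\<integral>\<^sup>+r. emeasure (k x r) A \<partial>?G)
      = (\<integral>\<^sup>+r. emeasure (P (r * t) t ((t / s) powr \<kappa> * r powr \<kappa> * x)) A \<partial>?G)" for A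
    unfolding k_def
  proof (intro nn_integral_cong_AE, eventually_elim)
    fix r :: real assume "0 < r \<and> r \<le> 1"
    then have "clamp t (r * t) = r * t" using t by (simp add: mult_left_le_one_le)
    then show "emeasure (P (clamp t (r * t)) t ((t / s) powr \<kappa> * r powr \<kappa> * x)) A
        = emeasure (P (r * t) t ((t / s) powr \<kappa> * r powr \<kappa> * x)) A" by simp
  qed
  have km': "k x \<in> measurable ?G (subprob_algebra borel)"
    using km Gs by (simp cong: measurable_cong_sets)
  let ?b = "?G \<bind> k x"
  have bs: "sets ?b = sets borel"
    by (rule sets_bind_measurable[OF km' G.not_empty])
  have bsp: "space ?b = UNIV"
    using sets_eq_imp_space_eq[OF bs] by simp
  have "?b = measure_of (space ?b) (sets ?b) (emeasure ?b)"
    by (rule measure_of_of_measure[symmetric])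
  also have "\<dots> = measure_of UNIV (sets borel) (emeasure ?b)"
    by (simp add: bs bsp)
  also have "\<dots> = measure_of UNIV (sets borel)
      (\<lambda>B. \<integral>\<^sup>+r. emeasure (P (r * t) t ((t / s) powr \<kappa> * r powr \<kappa> * x)) B \<partial>?G)"
  proof (rule measure_of_eq)
    fix A :: "real set" assume "A \<in> sigma_sets UNIV (sets borel)"
    then have "A \<in> sets borel" using sets.sigma_sets_eq[of "borel :: real measure"] by simp
    then show "emeasure ?b A = (\<integral>\<^sup>+r. emeasure (P (r * t) t ((t / s) powr \<kappa> * r powr \<kappa> * x)) A \<partial>?G)"
      using emeasure_bind[OF G.not_empty km'] eq by simp
  qed simp
  also have "\<dots> = ss_transition \<kappa> P (R_law N \<zeta>) s t x"
    using st by (simp add: ss_transition_def)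
  finally show ?eq by simp
qed

lemma measure_ss_transition:
  assumes st: "0 < s" "s \<le> t" and B: "B \<in> sets borel"
  shows "measure (ss_transition \<kappa> P (R_law N \<zeta>) s t x) B = (\<integral>\<eta>. kern s t B (\<zeta> (ln (t / s)) \<eta>) x \<partial>N)"
proof -
  let ?k = "\<lambda>x r. P (clamp t (r * t)) t ((t / s) powr \<kappa> * r powr \<kappa> * x)"
  let ?h = "ln (t / s)"
  let ?G = "R_law N \<zeta> (t / s)"
  interpret G: prob_space ?G by (rule ss_transition_eq_bind(2)[OF st])
  have km: "?k x \<in> measurable borel (subprob_algebra borel)"
    by (rule ss_transition_eq_bind(1)[OF st])
  then have km': "?k x \<in> measurable ?G (subprob_algebra borel)"
    by (simp add: R_law_def cong: measurable_cong_sets)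
  have h: "0 \<le> ?h" using st by simp
  have Rm: "(\<lambda>\<eta>. exp (- \<zeta> ?h \<eta>)) \<in> borel_measurable N"
    using zeta_measurable[OF h] by measurable
  have "measure (?G \<bind> ?k x) B = (\<integral>r. measure (?k x r) B \<partial>?G)"
    by (rule subprob_space.measure_bind[OF _ km' B]) (rule prob_space_imp_subprob_space, unfold_locales)
  also have "\<dots> = (\<integral>\<eta>. measure (?k x (exp (- \<zeta> ?h \<eta>))) B \<partial>N)"
    unfolding R_law_def
    by (rule integral_distr[OF Rm measurable_compose[OF km measurable_measure_subprob_algebra[OF B]]])
  also have "\<dots> = (\<integral>\<eta>. kern s t B (\<zeta> ?h \<eta>) x \<partial>N)"
    by (simp add: kern_def powr_def mult.commute)
  finally show ?thesis
    unfolding ss_transition_eq_bind(3)[OF st] .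
qed

lemma ss_transition_measurable:
  assumes st: "0 < s" "s \<le> t" and B: "B \<in> sets borel"
  shows "(\<lambda>x. measure (ss_transition \<kappa> P (R_law N \<zeta>) s t x) B) \<in> borel_measurable borel"
proof -
  have "0 \<le> ln (t / s)" using st by simp
  then have "(\<lambda>p. kern s t B (\<zeta> (ln (t / s)) (snd p)) (fst p)) \<in> borel_measurable (borel \<Otimes>\<^sub>M N)"
    using st B by (intro kern_measurable_compose measurable_compose[OF measurable_snd]) auto
  then show ?thesis
    unfolding measure_ss_transition[OF assms]
    by (intro N.borel_measurable_lebesgue_integral) (simp add: split_beta')
qed

lemma markov_kernels_ss_transition: "markov_kernels (ss_transition \<kappa> P (R_law N \<zeta>))"
proof -
  have P0: "markov_kernels P" using Z_markov by (simp add: markov_process_def)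
  have eq0: "ss_transition \<kappa> P (R_law N \<zeta>) 0 t x = P 0 t x" for t x
    by (simp add: ss_transition_def)
  show ?thesis
    unfolding markov_kernels_def
  proof (intro conjI allI impI)
    fix s t x :: real assume st: "0 \<le> s" "s \<le> t"
    have "prob_space (ss_transition \<kappa> P (R_law N \<zeta>) s t x) \<and> sets (ss_transition \<kappa> P (R_law N \<zeta>) s t x) = sets borel"
    proof (cases "s = 0")
      case True
      then show ?thesis using P0 st by (simp add: eq0 markov_kernels_def)
    next
      case False
      with st have s: "0 < s" by simp
      let ?k = "\<lambda>x r. P (clamp t (r * t)) t ((t / s) powr \<kappa> * r powr \<kappa> * x)"
      interpret G: prob_space "R_law N \<zeta> (t / s)" by (rule ss_transition_eq_bind(2)[OF s st(2)])
      have km: "?k x \<in> measurable (R_law N \<zeta> (t / s)) (subprob_algebra borel)"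
        using ss_transition_eq_bind(1)[OF s st(2)] by (simp add: R_law_def cong: measurable_cong_sets)
      show ?thesis
        unfolding ss_transition_eq_bind(3)[OF s st(2)]
        using st by (intro conjI G.prob_space_bind[OF _ km] sets_bind_measurable[OF km G.not_empty] AE_I2 P_prob_space) auto
    qed
    then show "prob_space (ss_transition \<kappa> P (R_law N \<zeta>) s t x)"
      "sets (ss_transition \<kappa> P (R_law N \<zeta>) s t x) = sets borel" by auto
  next
    fix s t :: real and B :: "real set" assume st: "0 \<le> s" "s \<le> t" "B \<in> sets borel"
    show "(\<lambda>x. measure (ss_transition \<kappa> P (R_law N \<zeta>) s t x) B) \<in> borel_measurable borel"
      using st P0 ss_transition_measurable[of s t B] by (cases "s = 0") (auto simp: eq0 markov_kernels_def)
  qed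
qed


section \<open>The Markov property\<close>

text \<open>Rewrites cylinders of the weighted process as cylinders of \<open>V\<close>. Taking a
  preimage instead of dividing by the weights also covers time 0, whose weight is 0.\<close>

lemma weighted_cylinder:
  fixes w :: "'i \<Rightarrow> real"
  assumes "E \<in> sets (PiM J (\<lambda>_. borel))"
  defines "E' \<equiv> (\<lambda>x. \<lambda>j\<in>J. w j * x j) -` E \<inter> space (PiM J (\<lambda>_. borel))"
  shows "E' \<in> sets (PiM J (\<lambda>_. borel))"
    and "indicator E (\<lambda>j\<in>J. w j * z j) = (indicator E' (\<lambda>j\<in>J. z j) :: real)"
proof -
  have "(\<lambda>x. \<lambda>j\<in>J. w j * x j) \<in> measurable (PiM J (\<lambda>_. borel)) (PiM J (\<lambda>_. borel :: real measure))"
    by (intro measurable_restrict borel_measurable_times borel_measurable_const measurable_component_singleton)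
  from measurable_sets[OF this assms(1)] show "E' \<in> sets (PiM J (\<lambda>_. borel))"
    unfolding E'_def .
  have "(\<lambda>j\<in>J. w j * (\<lambda>j\<in>J. z j) j) = (\<lambda>j\<in>J. w j * z j)"
    by (simp cong: restrict_cong)
  then show "indicator E (\<lambda>j\<in>J. w j * z j) = (indicator E' (\<lambda>j\<in>J. z j) :: real)"
    by (simp add: E'_def indicator_def space_PiM)
qed

lemma V_markov_kern:
  assumes J: "finite J" "k \<in> J" and \<tau>: "\<And>j. j \<in> J \<Longrightarrow> \<tau> j \<le> \<tau> k" and d: "0 \<le> d" and st: "0 < s" "0 < t"
    and E: "E \<in> sets (PiM J (\<lambda>_. borel))" and B: "B \<in> sets borel"
  shows "(\<integral>\<omega>. indicator E (\<lambda>j\<in>J. w j * V (\<tau> j) \<omega>) * indicator B (t powr \<kappa> * V (\<tau> k + d) \<omega>) \<partial>MZ)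
    = (\<integral>\<omega>. indicator E (\<lambda>j\<in>J. w j * V (\<tau> j) \<omega>) * kern s t B d (s powr \<kappa> * V (\<tau> k) \<omega>) \<partial>MZ)"
proof -
  have "clamp t (t * exp (- d)) = t * exp (- d)"
    using st d by (simp add: mult_right_le_one_le)
  moreover have "(t / s) powr \<kappa> * exp (- \<kappa> * d) * (s powr \<kappa> * v) = t powr \<kappa> * exp (- \<kappa> * d) * v" for v
    using st by (simp add: powr_divide)
  ultimately have "kern s t B d (s powr \<kappa> * V (\<tau> k) \<omega>)
      = measure (P (t * exp (- d)) t (t powr \<kappa> * exp (- \<kappa> * d) * V (\<tau> k) \<omega>)) B" for \<omega>
    by (simp only: kern_def)
  then show ?thesis
    using V_markov[where \<tau>=\<tau>, OF J \<tau> d st(2) weighted_cylinder(1)[where w=w, OF E] B]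
    by (simp only: weighted_cylinder(2)[where w=w, OF E])
qed

lemma V_martingale_weighted:
  assumes "martingale MZ Z"
    and J: "finite J" "k \<in> J" and \<tau>: "\<And>j. j \<in> J \<Longrightarrow> \<tau> j \<le> \<tau> k" and d: "0 \<le> d"
    and E: "E \<in> sets (PiM J (\<lambda>_. borel))"
  shows "(\<integral>\<omega>. indicator E (\<lambda>j\<in>J. w j * V (\<tau> j) \<omega>) * V (\<tau> k + d) \<omega> \<partial>MZ)
    = exp (- \<kappa> * d) * (\<integral>\<omega>. indicator E (\<lambda>j\<in>J. w j * V (\<tau> j) \<omega>) * V (\<tau> k) \<omega> \<partial>MZ)"
  using V_martingale[where \<tau>=\<tau>, OF assms(1) J \<tau> d weighted_cylinder(1)[where w=w, OF E]]
  by (simp only: weighted_cylinder(2)[where w=w, OF E])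

lemma lag_add: "0 < s \<Longrightarrow> s \<le> t \<Longrightarrow> a \<le> ln s \<Longrightarrow> lag a t = lag a s + ln (t / s)"
proof -
  assume "0 < s" "s \<le> t" "a \<le> ln s"
  moreover from this have "ln s \<le> ln t" by (subst ln_le_cancel_iff) auto
  ultimately show ?thesis by (simp add: lag_def ln_div max_def del: ln_le_cancel_iff)
qed

text \<open>Each pair of times is ordered only off a null set of its own; finiteness of
  \<open>J\<close> gives one null set for all.\<close>

lemma AE_zeta_ordered:
  assumes "finite J" "\<And>r. r \<in> J \<Longrightarrow> r \<le> s"
  shows "AE \<eta> in N. \<forall>r\<in>J. \<zeta> (lag a r) \<eta> \<le> \<zeta> (lag a s) \<eta>"
  using assms by (intro AE_finite_allI zeta_mono lag_nonneg lag_mono)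

text \<open>The freezing argument: the next increment is independent of the past, so it may be
  replaced by a fresh copy integrated separately. The bound is asked only for
  \<open>0 \<le> d\<close>, where the increment lives almost surely; the martingale case needs this,
  since \<open>exp (- \<kappa> * d)\<close> is unbounded for negative \<open>d\<close>.\<close>

lemma integral_past_increment:
  fixes \<Psi> :: "(real \<Rightarrow> real) \<times> real \<Rightarrow> real"
  assumes J: "finite J" "\<And>r. r \<in> J \<Longrightarrow> r \<le> s" and st: "0 < s" "s \<le> t" "a \<le> ln s"
    and \<Psi>: "\<Psi> \<in> borel_measurable (PiM J (\<lambda>_. borel) \<Otimes>\<^sub>M borel)" and bound: "\<And>y d. 0 \<le> d \<Longrightarrow> \<bar>\<Psi> (y, d)\<bar> \<le> C"
  shows "(\<integral>\<eta>. \<Psi> (\<lambda>r\<in>J. \<zeta> (lag a r) \<eta>, \<zeta> (lag a t) \<eta> - \<zeta> (lag a s) \<eta>) \<partial>N)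
    = (\<integral>\<eta>. \<integral>\<eta>'. \<Psi> (\<lambda>r\<in>J. \<zeta> (lag a r) \<eta>, \<zeta> (ln (t / s)) \<eta>') \<partial>N \<partial>N)"
proof -
  let ?h = "ln (t / s)"
  let ?\<xi> = "\<lambda>\<eta>. \<lambda>r\<in>J. \<zeta> (lag a r) \<eta>"
  let ?PJ = "PiM J (\<lambda>_. borel :: real measure)"
  have h: "0 \<le> ?h" using st by simp
  have \<xi>m: "?\<xi> \<in> measurable N ?PJ"
    by (intro measurable_restrict zeta_measurable lag_nonneg)
  have hm: "\<zeta> ?h \<in> borel_measurable N" using h by simp
  have Dm: "(\<lambda>\<eta>. \<zeta> (lag a s + ?h) \<eta> - \<zeta> (lag a s) \<eta>) \<in> borel_measurable N"
    by (intro borel_measurable_diff zeta_measurable add_nonneg_nonneg lag_nonneg h)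
  interpret A: prob_space "distr N ?PJ ?\<xi>" by (rule N.prob_space_distr[OF \<xi>m])
  interpret H: prob_space "distr N borel (\<zeta> ?h)" by (rule N.prob_space_distr[OF hm])
  interpret AH: pair_prob_space "distr N ?PJ ?\<xi>" "distr N borel (\<zeta> ?h)" ..
  have \<Psi>': "\<Psi> \<in> borel_measurable (distr N ?PJ ?\<xi> \<Otimes>\<^sub>M distr N borel (\<zeta> ?h))"
    using \<Psi> by (simp cong: measurable_cong_sets)
  have eq: "distr N (?PJ \<Otimes>\<^sub>M borel) (\<lambda>\<eta>. (?\<xi> \<eta>, \<zeta> (lag a s + ?h) \<eta> - \<zeta> (lag a s) \<eta>))
      = distr N ?PJ ?\<xi> \<Otimes>\<^sub>M distr N borel (\<zeta> ?h)"
    using J by (intro distr_zeta_past_increment_indexed conjI lag_nonneg lag_mono h) auto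
  have "AE d in distr N borel (\<zeta> ?h). 0 \<le> d"
    using zeta_nonneg[OF h] by (subst AE_distr_iff[OF hm]) auto
  then have "AE p in distr N ?PJ ?\<xi> \<Otimes>\<^sub>M distr N borel (\<zeta> ?h). 0 \<le> snd p"
    by (intro AH.AE_pair_measure) (auto simp: space_pair_measure)
  then have int: "integrable (distr N ?PJ ?\<xi> \<Otimes>\<^sub>M distr N borel (\<zeta> ?h)) \<Psi>"
    using bound by (intro AH.P.integrable_const_bound[where B=C] \<Psi>') (auto elim!: AE_mp simp: split_paired_all)
  have "(\<integral>\<eta>. \<Psi> (?\<xi> \<eta>, \<zeta> (lag a t) \<eta> - \<zeta> (lag a s) \<eta>) \<partial>N)
      = (\<integral>p. \<Psi> p \<partial>distr N (?PJ \<Otimes>\<^sub>M borel) (\<lambda>\<eta>. (?\<xi> \<eta>, \<zeta> (lag a s + ?h) \<eta> - \<zeta> (lag a s) \<eta>)))"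
    unfolding lag_add[OF st] by (rule integral_distr[OF measurable_Pair[OF \<xi>m Dm] \<Psi>, symmetric])
  also have "\<dots> = (\<integral>y. \<integral>d. \<Psi> (y, d) \<partial>distr N borel (\<zeta> ?h) \<partial>distr N ?PJ ?\<xi>)"
    unfolding eq by (rule AH.integral_fst'[OF int, symmetric])
  also have "\<dots> = (\<integral>\<eta>. \<integral>d. \<Psi> (?\<xi> \<eta>, d) \<partial>distr N borel (\<zeta> ?h) \<partial>N)"
  proof (rule integral_distr[OF \<xi>m])
    have "(\<lambda>y. \<integral>d. \<Psi> (y, d) \<partial>distr N borel (\<zeta> ?h)) \<in> borel_measurable (distr N ?PJ ?\<xi>)"
      using \<Psi>' by (intro H.borel_measurable_lebesgue_integral) simp
    then show "(\<lambda>y. \<integral>d. \<Psi> (y, d) \<partial>distr N borel (\<zeta> ?h)) \<in> borel_measurable ?PJ"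
      by simp
  qed
  also have "\<dots> = (\<integral>\<eta>. \<integral>\<eta>'. \<Psi> (?\<xi> \<eta>, \<zeta> ?h \<eta>') \<partial>N \<partial>N)"
  proof (intro Bochner_Integration.integral_cong refl)
    fix \<eta> assume "\<eta> \<in> space N"
    then have "?\<xi> \<eta> \<in> space ?PJ" by (rule measurable_space[OF \<xi>m])
    then show "(\<integral>d. \<Psi> (?\<xi> \<eta>, d) \<partial>distr N borel (\<zeta> ?h)) = (\<integral>\<eta>'. \<Psi> (?\<xi> \<eta>, \<zeta> ?h \<eta>') \<partial>N)"
      by (intro integral_distr[OF hm] measurable_compose[OF measurable_Pair1' \<Psi>])
  qed
  finally show ?thesis .
qed

text \<open>For almost every fixed \<eta> the positions are ordered and the Markov property of
  \<open>V\<close> applies with the current increment as \<open>d\<close>. Freezing the past and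
  averaging over a fresh increment then turns \<open>kern\<close> into the new transition
  function.\<close>

lemma Y_markov:
  assumes J: "finite J" "s \<in> J" "\<And>r. r \<in> J \<Longrightarrow> r \<le> s" and st: "0 < s" "s \<le> t" "a \<le> ln s"
    and E: "E \<in> sets (PiM J (\<lambda>_. borel))" and B: "B \<in> sets borel"
  shows "(\<integral>p. indicator E (\<lambda>r\<in>J. Y a r p) * indicator B (Y a t p) \<partial>(N \<Otimes>\<^sub>M MZ))
    = (\<integral>p. indicator E (\<lambda>r\<in>J. Y a r p) * measure (ss_transition \<kappa> P (R_law N \<zeta>) s t (Y a s p)) B \<partial>(N \<Otimes>\<^sub>M MZ))"
proof -
  let ?h = "ln (t / s)"
  let ?\<xi> = "\<lambda>\<eta>. \<lambda>r\<in>J. \<zeta> (lag a r) \<eta>"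
  let ?D = "\<lambda>\<eta>. \<zeta> (lag a t) \<eta> - \<zeta> (lag a s) \<eta>"
  let ?PJ = "PiM J (\<lambda>_. borel :: real measure)"
  let ?K = "\<lambda>x. measure (ss_transition \<kappa> P (R_law N \<zeta>) s t x) B"
  define e where "e y \<omega> = (indicator E (\<lambda>r\<in>J. r powr \<kappa> * V (y r) \<omega>) :: real)" for y \<omega>
  \<comment> \<open>The expectation over \<open>Z\<close> for deterministic positions
    \<open>y\<close> and increment \<open>d\<close>; in this form \<open>d\<close> can be averaged
    separately.\<close>
  define \<Psi> where "\<Psi> = (\<lambda>(y, d). \<integral>\<omega>. e y \<omega> * kern s t B d (s powr \<kappa> * V (y s) \<omega>) \<partial>MZ)"
  have t: "0 < t" "0 \<le> t" using st by auto
  have h: "0 \<le> ?h" using st by simp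
  have hm [measurable]: "\<zeta> ?h \<in> borel_measurable N" using h by simp
  have e_pair: "(\<lambda>(y, \<omega>). e y \<omega>) \<in> borel_measurable (?PJ \<Otimes>\<^sub>M MZ)"
    using measurable_compose[OF V_vector_measurable borel_measurable_indicator[OF E], of "\<lambda>r. r powr \<kappa>"]
    by (simp add: e_def split_beta')
  have e_01: "0 \<le> e y \<omega>" "e y \<omega> \<le> 1" for y \<omega> by (auto simp: e_def)
  have ek: "norm (e y \<omega> * kern s t B d x) \<le> 1" for y \<omega> d x
    using mult_mono[of "e y \<omega>" 1 "kern s t B d x" 1] kern_nonneg[of s t B d x] kern_le_1[OF t(2), of s B d x] e_01[of y \<omega>]
    by (simp add: abs_mult)
  have comp: "(\<lambda>z. z s) \<in> borel_measurable ?PJ"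
    using J(2) by (intro measurable_component_singleton)
  have m1: "(\<lambda>((y, d), \<omega>). e y \<omega> * kern s t B d (s powr \<kappa> * V (y s) \<omega>)) \<in> borel_measurable ((?PJ \<Otimes>\<^sub>M borel) \<Otimes>\<^sub>M MZ)"
  proof -
    have "(\<lambda>p. (fst (fst p), snd p)) \<in> measurable ((?PJ \<Otimes>\<^sub>M borel) \<Otimes>\<^sub>M MZ) (?PJ \<Otimes>\<^sub>M MZ)" by measurable
    from measurable_compose[OF this e_pair]
    have 1: "(\<lambda>p. e (fst (fst p)) (snd p)) \<in> borel_measurable ((?PJ \<Otimes>\<^sub>M (borel :: real measure)) \<Otimes>\<^sub>M MZ)" by simp
    have "(\<lambda>p. fst (fst p) s) \<in> borel_measurable ((?PJ \<Otimes>\<^sub>M (borel :: real measure)) \<Otimes>\<^sub>M MZ)"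
      by (intro measurable_compose[OF _ comp]) measurable
    then have 2: "(\<lambda>p. s powr \<kappa> * V (fst (fst p) s) (snd p)) \<in> borel_measurable ((?PJ \<Otimes>\<^sub>M (borel :: real measure)) \<Otimes>\<^sub>M MZ)"
      by (intro borel_measurable_times borel_measurable_const V_measurable_compose measurable_snd)
    show ?thesis
      unfolding split_beta'
      by (intro borel_measurable_times 1 kern_measurable_compose[OF t(2) B _ 2]
          measurable_compose[OF measurable_fst measurable_snd])
  qed
  have \<Psi>m: "\<Psi> \<in> borel_measurable (?PJ \<Otimes>\<^sub>M borel)"
    using MZ.borel_measurable_lebesgue_integral[of "\<lambda>q \<omega>. e (fst q) \<omega> * kern s t B (snd q) (s powr \<kappa> * V (fst q s) \<omega>)"] m1
    by (simp add: \<Psi>_def split_beta')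
  have \<Psi>b: "\<bar>\<Psi> (y, d)\<bar> \<le> 1" for y d
  proof (cases "integrable MZ (\<lambda>\<omega>. e y \<omega> * kern s t B d (s powr \<kappa> * V (y s) \<omega>))")
    case True
    have "\<Psi> (y, d) \<le> 1"
      unfolding \<Psi>_def prod.case
      by (intro MZ.integral_le_const True AE_I2 abs_le_D1[OF ek[unfolded real_norm_def]])
    moreover have "0 \<le> \<Psi> (y, d)"
      unfolding \<Psi>_def prod.case
      by (intro Bochner_Integration.integral_nonneg mult_nonneg_nonneg e_01 kern_nonneg)
    ultimately show ?thesis by simp
  qed (simp add: \<Psi>_def not_integrable_integral_eq)
  have \<xi>m: "?\<xi> \<in> measurable N ?PJ"
    by (intro measurable_restrict zeta_measurable lag_nonneg)
  have ord: "AE \<eta> in N. \<forall>r\<in>J. \<zeta> (lag a r) \<eta> \<le> \<zeta> (lag a s) \<eta>"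
    using J(1,3) by (rule AE_zeta_ordered)
  have e_Y: "indicator E (\<lambda>r\<in>J. Y a r (\<eta>, \<omega>)) = e (?\<xi> \<eta>) \<omega>" for \<eta> \<omega>
    by (simp add: e_def Y_def cong: restrict_cong)
  have Y_s: "Y a s (\<eta>, \<omega>) = s powr \<kappa> * V (?\<xi> \<eta> s) \<omega>" for \<eta> \<omega>
    using J(2) by (simp add: Y_def)
  have E_meas: "(\<lambda>p. indicator E (\<lambda>r\<in>J. Y a r p) :: real) \<in> borel_measurable (N \<Otimes>\<^sub>M MZ)"
    by (rule measurable_compose[OF Y_restrict_measurable borel_measurable_indicator[OF E]])
  have K_meas: "(\<lambda>p. ?K (Y a s p)) \<in> borel_measurable (N \<Otimes>\<^sub>M MZ)"
    by (rule measurable_compose[OF Y_measurable ss_transition_measurable[OF st(1,2) B]])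
  have B_meas: "(\<lambda>p. indicator B (Y a t p) :: real) \<in> borel_measurable (N \<Otimes>\<^sub>M MZ)"
    by (rule measurable_compose[OF Y_measurable borel_measurable_indicator[OF B]])
  have "(\<integral>p. indicator E (\<lambda>r\<in>J. Y a r p) * (indicator B (Y a t p) :: real) \<partial>(N \<Otimes>\<^sub>M MZ))
      = (\<integral>\<eta>. \<integral>\<omega>. indicator E (\<lambda>r\<in>J. Y a r (\<eta>, \<omega>)) * indicator B (Y a t (\<eta>, \<omega>)) \<partial>MZ \<partial>N)"
    using E_meas B_meas
    by (intro Q.integral_fst'[symmetric] Q.P.integrable_const_bound[where B=1] borel_measurable_times)
       (auto simp: indicator_def)
  also have "\<dots> = (\<integral>\<eta>. \<Psi> (?\<xi> \<eta>, ?D \<eta>) \<partial>N)"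
  proof (rule integral_cong_AE)
    show "AE \<eta> in N. (\<integral>\<omega>. indicator E (\<lambda>r\<in>J. Y a r (\<eta>, \<omega>)) * indicator B (Y a t (\<eta>, \<omega>)) \<partial>MZ) = \<Psi> (?\<xi> \<eta>, ?D \<eta>)"
      using ord zeta_mono[OF lag_nonneg lag_mono[OF st(2)], of a]
    proof eventually_elim
      fix \<eta> assume "\<forall>r\<in>J. \<zeta> (lag a r) \<eta> \<le> \<zeta> (lag a s) \<eta>" "\<zeta> (lag a s) \<eta> \<le> \<zeta> (lag a t) \<eta>"
      then show "(\<integral>\<omega>. indicator E (\<lambda>r\<in>J. Y a r (\<eta>, \<omega>)) * indicator B (Y a t (\<eta>, \<omega>)) \<partial>MZ) = \<Psi> (?\<xi> \<eta>, ?D \<eta>)"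
        using V_markov_kern[OF J(1,2), of "\<lambda>r. \<zeta> (lag a r) \<eta>" "?D \<eta>" s t E B "\<lambda>r. r powr \<kappa>"] st(1) t(1) E B J(2)
        by (simp add: Y_def \<Psi>_def e_def cong: restrict_cong)
    qed
    show "(\<lambda>\<eta>. \<integral>\<omega>. indicator E (\<lambda>r\<in>J. Y a r (\<eta>, \<omega>)) * (indicator B (Y a t (\<eta>, \<omega>)) :: real) \<partial>MZ) \<in> borel_measurable N"
      using borel_measurable_times[OF E_meas B_meas]
      by (intro MZ.borel_measurable_lebesgue_integral) (simp add: split_beta')
    show "(\<lambda>\<eta>. \<Psi> (?\<xi> \<eta>, ?D \<eta>)) \<in> borel_measurable N"
      by (intro measurable_compose[OF _ \<Psi>m] measurable_Pair \<xi>m borel_measurable_diff zeta_measurable lag_nonneg)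
  qed
  also have "\<dots> = (\<integral>\<eta>. \<integral>\<eta>'. \<Psi> (?\<xi> \<eta>, \<zeta> ?h \<eta>') \<partial>N \<partial>N)"
    by (rule integral_past_increment[OF J(1,3) st \<Psi>m \<Psi>b])
  also have "\<dots> = (\<integral>\<eta>. \<integral>\<omega>. indicator E (\<lambda>r\<in>J. Y a r (\<eta>, \<omega>)) * ?K (Y a s (\<eta>, \<omega>)) \<partial>MZ \<partial>N)"
  proof (intro Bochner_Integration.integral_cong refl)
    fix \<eta> assume \<eta>: "\<eta> \<in> space N"
    let ?y = "?\<xi> \<eta>"
    have y: "?y \<in> space ?PJ" using \<eta> by (rule measurable_space[OF \<xi>m])
    have "(\<lambda>p. ((?y, \<zeta> ?h (fst p)), snd p)) \<in> measurable (N \<Otimes>\<^sub>M MZ) ((?PJ \<Otimes>\<^sub>M borel) \<Otimes>\<^sub>M MZ)"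
      using y by (intro measurable_Pair measurable_const measurable_snd measurable_compose[OF measurable_fst hm])
    from measurable_compose[OF this m1]
    have m2: "(\<lambda>(\<eta>', \<omega>). e ?y \<omega> * kern s t B (\<zeta> ?h \<eta>') (s powr \<kappa> * V (?y s) \<omega>)) \<in> borel_measurable (N \<Otimes>\<^sub>M MZ)"
      by (simp add: split_beta')
    have "(\<integral>\<eta>'. \<Psi> (?y, \<zeta> ?h \<eta>') \<partial>N)
        = (\<integral>\<eta>'. \<integral>\<omega>. e ?y \<omega> * kern s t B (\<zeta> ?h \<eta>') (s powr \<kappa> * V (?y s) \<omega>) \<partial>MZ \<partial>N)"
      by (simp only: \<Psi>_def prod.case)
    \<comment> \<open>Exchanging the integrals brings the average over the fresh increment next to
      \<open>kern\<close>, where it is the mixture defining the new kernel.\<close>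
    also have "\<dots> = (\<integral>\<omega>. \<integral>\<eta>'. e ?y \<omega> * kern s t B (\<zeta> ?h \<eta>') (s powr \<kappa> * V (?y s) \<omega>) \<partial>N \<partial>MZ)"
      using ek
      by (intro Q.Fubini_integral[symmetric] Q.P.integrable_const_bound[where B=1] m2) (auto simp: split_beta')
    also have "\<dots> = (\<integral>\<omega>. indicator E (\<lambda>r\<in>J. Y a r (\<eta>, \<omega>)) * ?K (Y a s (\<eta>, \<omega>)) \<partial>MZ)"
      by (simp only: integral_mult_right_zero e_Y Y_s measure_ss_transition[OF st(1,2) B])
    finally show "(\<integral>\<eta>'. \<Psi> (?y, \<zeta> ?h \<eta>') \<partial>N)
      = (\<integral>\<omega>. indicator E (\<lambda>r\<in>J. Y a r (\<eta>, \<omega>)) * ?K (Y a s (\<eta>, \<omega>)) \<partial>MZ)" .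
  qed
  also have "\<dots> = (\<integral>p. indicator E (\<lambda>r\<in>J. Y a r p) * ?K (Y a s p) \<partial>(N \<Otimes>\<^sub>M MZ))"
  proof (intro Q.integral_fst' Q.P.integrable_const_bound[where B=1] borel_measurable_times E_meas K_meas AE_I2)
    have "?K x \<le> 1" for x
      using markov_kernels_ss_transition st(1,2)
      by (intro prob_space.prob_le_1) (simp add: markov_kernels_def)
    then show "norm (indicator E (\<lambda>r\<in>J. Y a r p) * ?K (Y a s p)) \<le> 1" for p
      by (simp add: indicator_def)
  qed
  finally show ?thesis .
qed


section \<open>Marginals, Markov process and self-similarity\<close>

text \<open>A single random position can be shifted, by an amount depending on itself, to the
  constant \<open>ln t\<close>, where \<open>t powr \<kappa> * V (ln t)\<close> is
  \<open>Z t\<close>.\<close>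

lemma distr_Y_single:
  assumes t: "0 < t"
  shows "distr (N \<Otimes>\<^sub>M MZ) (PiM {t} (\<lambda>_. borel)) (\<lambda>p. \<lambda>j\<in>{t}. Y a j p)
       = distr MZ (PiM {t} (\<lambda>_. borel)) (\<lambda>\<omega>. \<lambda>j\<in>{t}. Z j \<omega>)"
proof -
  let ?w = "\<lambda>t. t powr \<kappa>"
  let ?\<xi> = "\<lambda>\<eta>. \<lambda>j\<in>{t}. \<zeta> (lag a j) \<eta>"
  let ?v = "\<lambda>\<eta>. \<zeta> (lag a t) \<eta> - ln t"
  let ?c = "\<lambda>\<eta> :: 'b. \<lambda>j\<in>{t}. ln t"
  have \<xi>m: "?\<xi> \<in> measurable N (PiM {t} (\<lambda>_. borel))"
    by (intro measurable_restrict zeta_measurable lag_nonneg)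
  have vm: "?v \<in> borel_measurable N"
    by (intro borel_measurable_diff zeta_measurable lag_nonneg borel_measurable_const)
  have cm: "?c \<in> measurable N (PiM {t} (\<lambda>_. borel))"
    by (intro measurable_restrict borel_measurable_const)
  have "distr (N \<Otimes>\<^sub>M MZ) (PiM {t} (\<lambda>_. borel)) (\<lambda>p. \<lambda>j\<in>{t}. Y a j p) = mix {t} ?w ?\<xi>"
    by (rule distr_Y_mix) simp
  also have "\<dots> = mix {t} ?w (\<lambda>\<eta>. \<lambda>j\<in>{t}. ?\<xi> \<eta> j - ?v \<eta>)"
    by (rule mix_shift[OF _ \<xi>m vm]) simp
  also have "(\<lambda>\<eta>. \<lambda>j\<in>{t}. ?\<xi> \<eta> j - ?v \<eta>) = ?c"
    by (intro ext) (simp add: restrict_def)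
  also have "mix {t} ?w ?c = distr MZ (PiM {t} (\<lambda>_. borel)) (\<lambda>\<omega>. \<lambda>j\<in>{t}. Z j \<omega>)"
  proof (rule measure_eqI)
    fix E assume "E \<in> sets (mix {t} ?w ?c)"
    then have E: "E \<in> sets (PiM {t} (\<lambda>_. borel))" by (simp add: mix_def)
    have "(\<lambda>j\<in>{t}. ?w j * V (?c \<eta> j) \<omega>) = (\<lambda>j\<in>{t}. Z j \<omega>)" for \<eta> \<omega>
      by (intro restrict_ext) (simp add: Z_eq_V t)
    then show "emeasure (mix {t} ?w ?c) E = emeasure (distr MZ (PiM {t} (\<lambda>_. borel)) (\<lambda>\<omega>. \<lambda>j\<in>{t}. Z j \<omega>)) E"
      unfolding emeasure_mix[OF cm E] by (simp add: N.emeasure_space_1)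
  qed (simp add: mix_def)
  finally show ?thesis .
qed

lemma distr_Y:
  assumes t: "0 < t"
  shows "distr (N \<Otimes>\<^sub>M MZ) borel (Y a t) = distr MZ borel (Z t)"
proof -
  have "distr (N \<Otimes>\<^sub>M MZ) borel (\<lambda>p. (\<lambda>j\<in>{t}. Y a j p) t) = distr MZ borel (\<lambda>\<omega>. (\<lambda>j\<in>{t}. Z j \<omega>) t)"
    using t by (intro distr_eq_compose[OF distr_Y_single Y_restrict_measurable _ measurable_component_singleton]
        measurable_restrict) auto
  then show ?thesis by simp
qed

text \<open>Self-similarity at time 0 says that \<open>Z 0\<close> and
  \<open>c powr \<kappa> * Z 0\<close> have the same law for every \<open>c > 0\<close>. Letting
  \<open>c\<close> tend to 0 under the bounded test function \<open>f\<close> forces the mean of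
  \<open>f (Z 0)\<close> to be 0.\<close>

lemma Z_0: "AE \<omega> in MZ. Z 0 \<omega> = 0"
proof -
  define f :: "real \<Rightarrow> real" where "f x = min 1 \<bar>x\<bar>" for x
  have fm [measurable]: "f \<in> borel_measurable borel" unfolding f_def by measurable
  have Zm [measurable]: "Z 0 \<in> borel_measurable MZ" by simp
  have eq: "(\<integral>\<omega>. f (Z 0 \<omega>) \<partial>MZ) = (\<integral>\<omega>. f (inverse (real (Suc n)) * Z 0 \<omega>) \<partial>MZ)" for n
  proof -
    \<comment> \<open>Chosen so that \<open>c powr \<kappa>\<close> is the null sequence
      \<open>1 / Suc n\<close>.\<close>
    define c where "c = inverse (real (Suc n)) powr (1 / \<kappa>)"
    have c: "0 < c" "c powr \<kappa> = inverse (real (Suc n))"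
      using kappa_pos by (simp_all add: c_def powr_powr)
    have "distr MZ (PiM {()} (\<lambda>_. borel)) (\<lambda>\<omega>. \<lambda>j\<in>{()}. Z (c * 0) \<omega>)
        = distr MZ (PiM {()} (\<lambda>_. borel)) (\<lambda>\<omega>. \<lambda>j\<in>{()}. c powr \<kappa> * Z 0 \<omega>)"
      using c by (intro Z_self_similar_indexed) auto
    then have "distr MZ borel (\<lambda>\<omega>. f ((\<lambda>j\<in>{()}. Z (c * 0) \<omega>) ())) = distr MZ borel (\<lambda>\<omega>. f ((\<lambda>j\<in>{()}. c powr \<kappa> * Z 0 \<omega>) ()))"
      by (rule distr_eq_compose[where g="\<lambda>y. f (y ())"]) (auto intro!: measurable_restrict)
    then have "distr MZ borel (\<lambda>\<omega>. f (Z 0 \<omega>)) = distr MZ borel (\<lambda>\<omega>. f (inverse (real (Suc n)) * Z 0 \<omega>))"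
      by (simp add: c)
    then have "(\<integral>x. x \<partial>distr MZ borel (\<lambda>\<omega>. f (Z 0 \<omega>))) = (\<integral>x. x \<partial>distr MZ borel (\<lambda>\<omega>. f (inverse (real (Suc n)) * Z 0 \<omega>)))"
      by simp
    then show ?thesis
      by (subst (asm) (1 2) integral_distr) auto
  qed
  have "(\<lambda>n. \<integral>\<omega>. f (inverse (real (Suc n)) * Z 0 \<omega>) \<partial>MZ) \<longlonglongrightarrow> (\<integral>\<omega>. 0 \<partial>MZ)"
  proof (rule integral_dominated_convergence[where w="\<lambda>_. 1"])
    show "AE \<omega> in MZ. (\<lambda>n. f (inverse (real (Suc n)) * Z 0 \<omega>)) \<longlonglongrightarrow> 0"
    proof (rule AE_I2)
      fix \<omega>
      have "(\<lambda>n. min 1 \<bar>inverse (real (Suc n)) * Z 0 \<omega>\<bar>) \<longlonglongrightarrow> min 1 \<bar>0 * Z 0 \<omega>\<bar>"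
        by (intro tendsto_min tendsto_const tendsto_rabs tendsto_mult LIMSEQ_inverse_real_of_nat)
      then show "(\<lambda>n. f (inverse (real (Suc n)) * Z 0 \<omega>)) \<longlonglongrightarrow> 0" by (simp add: f_def)
    qed
  qed (auto simp: f_def)
  then have "(\<lambda>n. \<integral>\<omega>. f (Z 0 \<omega>) \<partial>MZ) \<longlonglongrightarrow> 0" using eq by simp
  then have "(\<integral>\<omega>. f (Z 0 \<omega>) \<partial>MZ) = 0" by (simp add: LIMSEQ_const_iff)
  then have "AE \<omega> in MZ. f (Z 0 \<omega>) = 0"
    by (subst (asm) integral_nonneg_eq_0_iff_AE)
       (auto simp: f_def intro!: MZ.integrable_const_bound[where B=1])
  then show ?thesis by (auto simp: f_def min_def split: if_splits elim!: AE_mp)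
qed

lemma distr_X_single:
  assumes "0 \<le> t"
  shows "distr KL.lim borel (X t) = distr MZ borel (Z t)"
proof (cases "t = 0")
  case True
  have "distr KL.lim borel (X 0) = distr KL.lim borel (\<lambda>_. 0)"
    by (simp add: X_def[abs_def])
  also have "\<dots> = return borel 0" by (rule KL.P.distr_const) simp
  also have "\<dots> = distr MZ borel (\<lambda>_. 0)" by (rule MZ.distr_const[symmetric]) simp
  also have "\<dots> = distr MZ borel (Z 0)"
    using Z_0 by (intro distr_cong_AE') auto
  finally show ?thesis by (simp add: True)
next
  case False
  with assms have t: "0 < t" by simp
  have "distr KL.lim borel (\<lambda>\<omega>. (\<lambda>j\<in>{t}. X j \<omega>) t) = distr (N \<Otimes>\<^sub>M MZ) borel (\<lambda>p. (\<lambda>j\<in>{t}. Y (ln t) j p) t)"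
    using t by (intro distr_eq_compose[OF distr_X X_restrict_measurable Y_restrict_measurable measurable_component_singleton]) auto
  then show ?thesis by (simp add: distr_Y t)
qed

lemma X_integral:
  fixes f :: "(real \<Rightarrow> real) \<Rightarrow> real"
  assumes J: "finite J" "J \<subseteq> {0..}" and a: "\<And>t. t \<in> J \<Longrightarrow> 0 < t \<Longrightarrow> a \<le> ln t"
    and f: "f \<in> borel_measurable (PiM J (\<lambda>_. borel))"
  shows "(\<integral>\<omega>. f (\<lambda>t\<in>J. X t \<omega>) \<partial>KL.lim) = (\<integral>p. f (\<lambda>t\<in>J. Y a t p) \<partial>(N \<Otimes>\<^sub>M MZ))"
  using integral_distr[OF X_restrict_measurable[OF J(2)] f] integral_distr[OF Y_restrict_measurable f, of a]
    distr_X[OF J a] by simp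

text \<open>The law of \<open>Z 0\<close> is a point mass at 0, so here the almost everywhere
  information on the kernel determines its value at the one state that matters.\<close>

lemma measure_P_0:
  assumes t: "0 \<le> t" and B: "B \<in> sets borel"
  shows "measure (P 0 t 0) B = measure (distr MZ borel (Z t)) B"
proof -
  have sp: "space MZ \<in> nat_filtration MZ Z 0"
    unfolding nat_filtration_def by (rule sigma_sets_top)
  have Pm: "(\<lambda>x. measure (P 0 t x) B) \<in> borel_measurable borel"
    using Z_markov t B by (auto simp: markov_process_def markov_kernels_def)
  have Z0m: "Z 0 \<in> borel_measurable MZ" by simp
  have "measure (distr MZ borel (Z t)) B = measure MZ (space MZ \<inter> (Z t -` B \<inter> space MZ))"
    using t B by (simp add: measure_distr Int_absorb1)
  also have "\<dots> = (LINT \<omega>:space MZ|MZ. measure (P 0 t (Z 0 \<omega>)) B)"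
    unfolding measure_Int_vimage_eq_set_integral by (rule Z_markov_set_integral[OF order_refl t sp B])
  also have "\<dots> = (\<integral>\<omega>. measure (P 0 t (Z 0 \<omega>)) B \<partial>MZ)"
    unfolding set_lebesgue_integral_def by (intro Bochner_Integration.integral_cong) auto
  also have "\<dots> = (\<integral>\<omega>. measure (P 0 t 0) B \<partial>MZ)"
    using Z_0 measurable_compose[OF Z0m Pm] by (intro integral_cong_AE) auto
  finally show ?thesis by (simp add: MZ.prob_space)
qed

lemma X_0_cylinder:
  assumes "J \<subseteq> {0..0}" "0 \<in> J"
  shows "(\<lambda>t\<in>J. X t \<omega>) = (\<lambda>t\<in>{0}. 0)"
proof -
  have "J = {0}" using assms by auto
  then show ?thesis by (auto simp: X_def)
qed

lemma markov_X: "markov_process KL.lim X (ss_transition \<kappa> P (R_law N \<zeta>))"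
  unfolding markov_process_def
proof (intro conjI allI impI)
  show "prob_space KL.lim" by (rule KL.P.prob_space_axioms)
  show "markov_kernels (ss_transition \<kappa> P (R_law N \<zeta>))" by (rule markov_kernels_ss_transition)
  show Xm: "X t \<in> borel_measurable KL.lim" if "0 \<le> t" for t using that by (rule X_measurable)
  fix s t :: real and A and B :: "real set"
  assume st: "0 \<le> s" "s \<le> t" and A: "A \<in> nat_filtration KL.lim X s" and B: "B \<in> sets borel"
  let ?K = "\<lambda>x. measure (ss_transition \<kappa> P (R_law N \<zeta>) s t x) B"
  have Km: "?K \<in> borel_measurable borel"
    using markov_kernels_ss_transition st B by (simp add: markov_kernels_def)
  have K1: "?K x \<le> 1" for x
    using markov_kernels_ss_transition st by (intro prob_space.prob_le_1) (simp add: markov_kernels_def)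
  have XB: "(\<lambda>\<omega>. indicator B (X t \<omega>) :: real) \<in> borel_measurable KL.lim"
    using st by (intro measurable_compose[OF Xm borel_measurable_indicator[OF B]]) simp
  have "(LINT \<omega>:A|KL.lim. indicator B (X t \<omega>)) = (LINT \<omega>:A|KL.lim. ?K (X s \<omega>))"
  proof (rule nat_filtration_set_integral_eqI[OF Xm _ _ st(1) _ A])
    show "integrable KL.lim (\<lambda>\<omega>. indicator B (X t \<omega>) :: real)"
      by (intro KL.P.integrable_const_bound[where B=1] XB) (simp add: indicator_def)
    show "integrable KL.lim (\<lambda>\<omega>. ?K (X s \<omega>))"
      using K1 by (intro KL.P.integrable_const_bound[where B=1] measurable_compose[OF Xm[OF st(1)] Km]) simp
    fix J and E :: "(real \<Rightarrow> real) set"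
    assume J: "finite J" "J \<subseteq> {0..s}" "s \<in> J" and E: "E \<in> sets (PiM J (\<lambda>_. borel))"
    show "(\<integral>\<omega>. indicator E (\<lambda>t\<in>J. X t \<omega>) * indicator B (X t \<omega>) \<partial>KL.lim)
        = (\<integral>\<omega>. indicator E (\<lambda>t\<in>J. X t \<omega>) * ?K (X s \<omega>) \<partial>KL.lim)"
    proof (cases "s = 0")
      \<comment> \<open>At time 0 the past is constant, so the indicator of \<open>E\<close> is
        constant too and only the law of \<open>X t\<close> has to be compared with
        \<open>P 0 t 0\<close>.\<close>
      case True
      have "(\<integral>\<omega>. indicator B (X t \<omega>) \<partial>KL.lim) = measure KL.lim (UNIV \<inter> (X t -` B \<inter> space KL.lim))"
        unfolding measure_Int_vimage_eq_set_integral by (simp add: set_lebesgue_integral_def)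
      also have "\<dots> = measure (distr KL.lim borel (X t)) B"
        using B st by (subst measure_distr) (auto simp: X_measurable)
      also have "\<dots> = measure (P 0 t 0) B"
        using st B by (simp add: distr_X_single measure_P_0)
      finally show ?thesis
        using J unfolding True
        by (subst (1 2) X_0_cylinder) (auto simp: ss_transition_def X_def KL.P.prob_space[unfolded KL.space_lim])
    next
      case False
      with st have s: "0 < s" by simp
      let ?J = "insert t J"
      \<comment> \<open>This start is at most \<open>ln s\<close>, so the lags of \<open>s\<close>
        and \<open>t\<close> are not truncated and differ by \<open>ln (t / s)\<close>.\<close>
      let ?a = "base ?J"
      have J': "finite ?J" "?J \<subseteq> {0..}" using J st by auto
      have a: "?a \<le> ln r" if "r \<in> ?J" "0 < r" for r using base_le[OF J'] that by blast
      have tm: "(\<lambda>y. y t) \<in> borel_measurable (PiM ?J (\<lambda>_. borel :: real measure))"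
        and sm: "(\<lambda>y. y s) \<in> borel_measurable (PiM J (\<lambda>_. borel :: real measure))"
        using J(3) by (auto intro!: measurable_component_singleton)
      have f1: "(\<lambda>y. indicator E (restrict y J) * indicator B (y t) :: real) \<in> borel_measurable (PiM ?J (\<lambda>_. borel))"
        by (intro borel_measurable_times measurable_compose[OF measurable_restrict_subset borel_measurable_indicator[OF E]]
            measurable_compose[OF tm borel_measurable_indicator[OF B]]) auto
      have f2: "(\<lambda>y. indicator E y * ?K (y s)) \<in> borel_measurable (PiM J (\<lambda>_. borel))"
        by (intro borel_measurable_times borel_measurable_indicator E
            measurable_compose[OF sm Km])
      have res: "restrict (\<lambda>r\<in>?J. z r) J = (\<lambda>r\<in>J. z r)" for z :: "real \<Rightarrow> real"
        by (auto simp: restrict_def)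
      have "(\<integral>\<omega>. indicator E (\<lambda>t\<in>J. X t \<omega>) * (indicator B (X t \<omega>) :: real) \<partial>KL.lim)
          = (\<integral>p. indicator E (\<lambda>t\<in>J. Y ?a t p) * indicator B (Y ?a t p) \<partial>(N \<Otimes>\<^sub>M MZ))"
        using X_integral[OF J' a f1] unfolding res by simp
      also have "\<dots> = (\<integral>p. indicator E (\<lambda>t\<in>J. Y ?a t p) * ?K (Y ?a s p) \<partial>(N \<Otimes>\<^sub>M MZ))"
        using J by (intro Y_markov s st(2) a E B) auto
      also have "\<dots> = (\<integral>\<omega>. indicator E (\<lambda>t\<in>J. X t \<omega>) * ?K (X s \<omega>) \<partial>KL.lim)"
        using X_integral[OF J(1) _ _ f2, of ?a] J' a J(3) by simp
      finally show ?thesis .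
    qed
  qed
  then show "measure KL.lim (A \<inter> (X t -` B \<inter> space KL.lim)) = (LINT \<omega>:A|KL.lim. ?K (X s \<omega>))"
    unfolding measure_Int_vimage_eq_set_integral .
qed

text \<open>Dilating time by \<open>c\<close> translates logarithmic time by \<open>ln c\<close>.
  Starting \<open>Y\<close> at \<open>a + ln c\<close> instead of \<open>a\<close> gives the scaling
  relation outcome by outcome, and the law of \<open>X\<close> does not see the change of
  start.\<close>

lemma self_similar_X: "self_similar KL.lim X \<kappa>"
  unfolding self_similar_def
proof (intro allI impI)
  fix c :: real and J :: "real set" assume c: "0 < c" and J: "finite J" "J \<subseteq> {0..}"
  let ?a = "base J"
  let ?H = "(\<lambda>t. c * t) ` J"
  have H: "finite ?H" "?H \<subseteq> {0..}" using J c by auto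
  have a: "?a + ln c \<le> ln r" if "r \<in> ?H" "0 < r" for r
  proof -
    from that(1) obtain t where t: "t \<in> J" "r = c * t" by auto
    with that c have "0 < t" by (simp add: zero_less_mult_iff)
    with base_le[OF J t(1)] t(2) c show ?thesis by (simp add: ln_mult)
  qed
  have scale: "Y (?a + ln c) (c * t) p = c powr \<kappa> * Y ?a t p" if "t \<in> J" for t p
  proof (cases "t = 0")
    case False
    with that J have "0 < t" by force
    with c have "lag (?a + ln c) (c * t) = lag ?a t"
      by (simp add: lag_def ln_mult mult_le_0_iff)
    with c \<open>0 < t\<close> show ?thesis by (simp add: Y_def split_beta' powr_mult)
  qed (simp add: Y_0)
  have HX: "(\<lambda>t\<in>J. (\<lambda>r\<in>?H. X r \<omega>) (c * t)) = (\<lambda>t\<in>J. X (c * t) \<omega>)" for \<omega>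
    by (intro restrict_ext) auto
  have HY: "(\<lambda>t\<in>J. (\<lambda>r\<in>?H. Y (?a + ln c) r p) (c * t)) = (\<lambda>t\<in>J. c powr \<kappa> * Y ?a t p)" for p
    by (intro restrict_ext) (auto simp: scale)
  have "distr KL.lim (PiM J (\<lambda>_. borel)) (\<lambda>\<omega>. \<lambda>t\<in>J. (\<lambda>r\<in>?H. X r \<omega>) (c * t))
      = distr (N \<Otimes>\<^sub>M MZ) (PiM J (\<lambda>_. borel)) (\<lambda>p. \<lambda>t\<in>J. (\<lambda>r\<in>?H. Y (?a + ln c) r p) (c * t))"
    by (rule distr_eq_compose[OF distr_X[OF H a] X_restrict_measurable[OF H(2)] Y_restrict_measurable measurable_reindex])
  then have "distr KL.lim (PiM J (\<lambda>_. borel)) (\<lambda>\<omega>. \<lambda>t\<in>J. X (c * t) \<omega>)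
      = distr (N \<Otimes>\<^sub>M MZ) (PiM J (\<lambda>_. borel)) (\<lambda>p. \<lambda>t\<in>J. c powr \<kappa> * Y ?a t p)"
    unfolding HX HY .
  also have "\<dots> = distr KL.lim (PiM J (\<lambda>_. borel)) (\<lambda>\<omega>. \<lambda>t\<in>J. c powr \<kappa> * X t \<omega>)"
  proof -
    have g: "(\<lambda>y. \<lambda>t\<in>J. c powr \<kappa> * y t) \<in> measurable (PiM J (\<lambda>_. borel)) (PiM J (\<lambda>_. borel :: real measure))"
      by (intro measurable_restrict borel_measurable_times borel_measurable_const measurable_component_singleton)
    have "distr KL.lim (PiM J (\<lambda>_. borel)) (\<lambda>\<omega>. \<lambda>t\<in>J. c powr \<kappa> * (\<lambda>t\<in>J. X t \<omega>) t)
        = distr (N \<Otimes>\<^sub>M MZ) (PiM J (\<lambda>_. borel)) (\<lambda>p. \<lambda>t\<in>J. c powr \<kappa> * (\<lambda>t\<in>J. Y ?a t p) t)"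
      by (rule distr_eq_compose[OF distr_X[OF J base_le[OF J]] X_restrict_measurable[OF J(2)] Y_restrict_measurable g])
    then show ?thesis by (simp cong: restrict_cong)
  qed
  finally show "distr KL.lim (PiM J (\<lambda>_. borel)) (\<lambda>\<omega>. \<lambda>t\<in>J. X (c * t) \<omega>)
      = distr KL.lim (PiM J (\<lambda>_. borel)) (\<lambda>\<omega>. \<lambda>t\<in>J. c powr \<kappa> * X t \<omega>)" .
qed


section \<open>The martingale property\<close>

text \<open>Given the time change, the step multiplies by \<open>exp (- \<kappa> * d)\<close>; its
  mean \<open>(s / t) powr \<kappa>\<close> exactly offsets the growth of the weight from
  \<open>s powr \<kappa>\<close> to \<open>t powr \<kappa>\<close>.\<close>

lemma Y_martingale:
  assumes mart: "martingale MZ Z"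
    and lap: "(\<integral>\<eta>. exp (- \<kappa> * \<zeta> (ln (t / s)) \<eta>) \<partial>N) = (s / t) powr \<kappa>"
    and J: "finite J" "s \<in> J" "\<And>r. r \<in> J \<Longrightarrow> r \<le> s" and st: "0 < s" "s \<le> t" "a \<le> ln s"
    and E: "E \<in> sets (PiM J (\<lambda>_. borel))"
  shows "(\<integral>p. indicator E (\<lambda>r\<in>J. Y a r p) * Y a t p \<partial>(N \<Otimes>\<^sub>M MZ))
    = (\<integral>p. indicator E (\<lambda>r\<in>J. Y a r p) * Y a s p \<partial>(N \<Otimes>\<^sub>M MZ))"
proof -
  let ?h = "ln (t / s)"
  let ?\<xi> = "\<lambda>\<eta>. \<lambda>r\<in>J. \<zeta> (lag a r) \<eta>"
  let ?D = "\<lambda>\<eta>. \<zeta> (lag a t) \<eta> - \<zeta> (lag a s) \<eta>"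
  let ?PJ = "PiM J (\<lambda>_. borel :: real measure)"
  define e where "e y \<omega> = (indicator E (\<lambda>r\<in>J. r powr \<kappa> * V (y r) \<omega>) :: real)" for y \<omega>
  define g where "g y = (\<integral>\<omega>. e y \<omega> * V (y s) \<omega> \<partial>MZ)" for y
  define \<Psi> where "\<Psi> = (\<lambda>(y, d). exp (- \<kappa> * d) * g y)"
  \<comment> \<open>All \<open>V b\<close> have the law of \<open>V 0\<close>, so this one first
    absolute moment bounds \<open>g\<close> uniformly over random positions.\<close>
  define C where "C = (\<integral>\<omega>. \<bar>V 0 \<omega>\<bar> \<partial>MZ)"
  have t: "0 < t" using st by auto
  have e_pair: "(\<lambda>(y, \<omega>). e y \<omega>) \<in> borel_measurable (?PJ \<Otimes>\<^sub>M MZ)"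
    using measurable_compose[OF V_vector_measurable borel_measurable_indicator[OF E], of "\<lambda>r. r powr \<kappa>"]
    by (simp add: e_def split_beta')
  have comp: "(\<lambda>z. z s) \<in> borel_measurable ?PJ"
    using J(2) by (intro measurable_component_singleton)
  have V_pair: "(\<lambda>p. V (fst p s) (snd p)) \<in> borel_measurable (?PJ \<Otimes>\<^sub>M MZ)"
    by (intro V_measurable_compose measurable_compose[OF measurable_fst comp] measurable_snd)
  have gm: "g \<in> borel_measurable ?PJ"
    unfolding g_def using borel_measurable_times[OF e_pair V_pair]
    by (intro MZ.borel_measurable_lebesgue_integral) (simp add: split_beta')
  have V_int: "integrable MZ (V b)" for b
    using mart unfolding V_def[abs_def] martingale_def by (intro integrable_mult_right) simp
  have g_bound: "\<bar>g y\<bar> \<le> C" for y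
  proof -
    have "\<bar>g y\<bar> \<le> (\<integral>\<omega>. \<bar>e y \<omega> * V (y s) \<omega>\<bar> \<partial>MZ)"
      unfolding g_def by (rule integral_abs_bound)
    also have "\<dots> \<le> (\<integral>\<omega>. \<bar>V (y s) \<omega>\<bar> \<partial>MZ)"
      using V_int by (intro integral_mono') (auto simp: e_def indicator_def)
    also have "\<dots> = C"
      unfolding C_def by (rule V_identically_distributed) simp
    finally show ?thesis .
  qed
  have C: "0 \<le> C" by (simp add: C_def)
  have \<Psi>m: "\<Psi> \<in> borel_measurable (?PJ \<Otimes>\<^sub>M borel)"
    unfolding \<Psi>_def split_beta'
    by (intro borel_measurable_times measurable_compose[OF measurable_fst gm] measurable_compose[OF measurable_snd]) auto
  have \<Psi>b: "\<bar>\<Psi> (y, d)\<bar> \<le> C" if "0 \<le> d" for y d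
  proof -
    have "exp (- \<kappa> * d) \<le> 1" using that kappa_pos by simp
    then have "exp (- \<kappa> * d) * \<bar>g y\<bar> \<le> 1 * C"
      using g_bound[of y] C by (intro mult_mono) auto
    then show ?thesis by (simp add: \<Psi>_def abs_mult)
  qed
  have \<xi>m: "?\<xi> \<in> measurable N ?PJ"
    by (intro measurable_restrict zeta_measurable lag_nonneg)
  have ord: "AE \<eta> in N. \<forall>r\<in>J. \<zeta> (lag a r) \<eta> \<le> \<zeta> (lag a s) \<eta>"
    using J(1,3) by (rule AE_zeta_ordered)
  have E_meas: "(\<lambda>p. indicator E (\<lambda>r\<in>J. Y a r p) :: real) \<in> borel_measurable (N \<Otimes>\<^sub>M MZ)"
    by (rule measurable_compose[OF Y_restrict_measurable borel_measurable_indicator[OF E]])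
  \<comment> \<open>Integrability on the product space is inherited from \<open>Z u\<close>, which
    has the same law as \<open>Y a u\<close>.\<close>
  have Y_int: "integrable (N \<Otimes>\<^sub>M MZ) (\<lambda>p. indicator E (\<lambda>r\<in>J. Y a r p) * Y a u p)" if u: "0 < u" for u
  proof -
    have "integrable MZ (Z u)" using mart u by (simp add: martingale_def)
    then have "integrable (distr MZ borel (Z u)) (\<lambda>x. x)"
      using u by (simp add: integrable_distr_eq)
    then have "integrable (N \<Otimes>\<^sub>M MZ) (Y a u)"
      unfolding distr_Y[OF u, of a, symmetric] by (simp add: integrable_distr_eq)
    then show ?thesis
      by (rule Bochner_Integration.integrable_bound[OF _ borel_measurable_times[OF E_meas Y_measurable]])
         (simp add: indicator_def)
  qed
  have "(\<integral>p. indicator E (\<lambda>r\<in>J. Y a r p) * Y a t p \<partial>(N \<Otimes>\<^sub>M MZ))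
      = (\<integral>\<eta>. \<integral>\<omega>. indicator E (\<lambda>r\<in>J. Y a r (\<eta>, \<omega>)) * Y a t (\<eta>, \<omega>) \<partial>MZ \<partial>N)"
    by (rule Q.integral_fst'[OF Y_int[OF t], symmetric])
  also have "\<dots> = (\<integral>\<eta>. t powr \<kappa> * \<Psi> (?\<xi> \<eta>, ?D \<eta>) \<partial>N)"
  proof (rule integral_cong_AE)
    show "AE \<eta> in N. (\<integral>\<omega>. indicator E (\<lambda>r\<in>J. Y a r (\<eta>, \<omega>)) * Y a t (\<eta>, \<omega>) \<partial>MZ) = t powr \<kappa> * \<Psi> (?\<xi> \<eta>, ?D \<eta>)"
      using ord zeta_mono[OF lag_nonneg lag_mono[OF st(2)], of a]
    proof eventually_elim
      fix \<eta> assume *: "\<forall>r\<in>J. \<zeta> (lag a r) \<eta> \<le> \<zeta> (lag a s) \<eta>" "\<zeta> (lag a s) \<eta> \<le> \<zeta> (lag a t) \<eta>"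
      have "(\<integral>\<omega>. indicator E (\<lambda>r\<in>J. Y a r (\<eta>, \<omega>)) * Y a t (\<eta>, \<omega>) \<partial>MZ)
          = (\<integral>\<omega>. t powr \<kappa> * (indicator E (\<lambda>r\<in>J. r powr \<kappa> * V (\<zeta> (lag a r) \<eta>) \<omega>) * V (\<zeta> (lag a s) \<eta> + ?D \<eta>) \<omega>) \<partial>MZ)"
        by (simp add: Y_def mult.left_commute)
      also have "\<dots> = t powr \<kappa> * (exp (- \<kappa> * ?D \<eta>) *
          (\<integral>\<omega>. indicator E (\<lambda>r\<in>J. r powr \<kappa> * V (\<zeta> (lag a r) \<eta>) \<omega>) * V (\<zeta> (lag a s) \<eta>) \<omega> \<partial>MZ))"
        unfolding integral_mult_right_zero
        using V_martingale_weighted[OF mart J(1,2), of "\<lambda>r. \<zeta> (lag a r) \<eta>" "?D \<eta>" E "\<lambda>r. r powr \<kappa>"] * E by simp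
      also have "\<dots> = t powr \<kappa> * \<Psi> (?\<xi> \<eta>, ?D \<eta>)"
        using J(2) by (simp add: \<Psi>_def g_def e_def cong: restrict_cong)
      finally show "(\<integral>\<omega>. indicator E (\<lambda>r\<in>J. Y a r (\<eta>, \<omega>)) * Y a t (\<eta>, \<omega>) \<partial>MZ) = t powr \<kappa> * \<Psi> (?\<xi> \<eta>, ?D \<eta>)" .
    qed
    show "(\<lambda>\<eta>. \<integral>\<omega>. indicator E (\<lambda>r\<in>J. Y a r (\<eta>, \<omega>)) * Y a t (\<eta>, \<omega>) \<partial>MZ) \<in> borel_measurable N"
      using borel_measurable_times[OF E_meas Y_measurable[of a t]]
      by (intro MZ.borel_measurable_lebesgue_integral) (simp add: split_beta')
    show "(\<lambda>\<eta>. t powr \<kappa> * \<Psi> (?\<xi> \<eta>, ?D \<eta>)) \<in> borel_measurable N"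
      by (intro borel_measurable_times borel_measurable_const measurable_compose[OF _ \<Psi>m] measurable_Pair \<xi>m
          borel_measurable_diff zeta_measurable lag_nonneg)
  qed
  also have "\<dots> = t powr \<kappa> * (\<integral>\<eta>. \<Psi> (?\<xi> \<eta>, ?D \<eta>) \<partial>N)"
    by (rule integral_mult_right_zero)
  also have "(\<integral>\<eta>. \<Psi> (?\<xi> \<eta>, ?D \<eta>) \<partial>N) = (\<integral>\<eta>. \<integral>\<eta>'. \<Psi> (?\<xi> \<eta>, \<zeta> ?h \<eta>') \<partial>N \<partial>N)"
    using J(3) by (intro integral_past_increment[OF J(1) _ st \<Psi>m \<Psi>b])
  \<comment> \<open>The fresh increment separates from \<open>g\<close> and contributes its Laplace
    transform at \<kappa>.\<close>
  also have "\<dots> = (s / t) powr \<kappa> * (\<integral>\<eta>. g (?\<xi> \<eta>) \<partial>N)"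
    by (simp only: \<Psi>_def prod.case integral_mult_left_zero lap integral_mult_right_zero)
  also have "t powr \<kappa> * ((s / t) powr \<kappa> * (\<integral>\<eta>. g (?\<xi> \<eta>) \<partial>N)) = s powr \<kappa> * (\<integral>\<eta>. g (?\<xi> \<eta>) \<partial>N)"
    using st t by (simp add: powr_divide)
  also have "\<dots> = (\<integral>\<eta>. \<integral>\<omega>. indicator E (\<lambda>r\<in>J. Y a r (\<eta>, \<omega>)) * Y a s (\<eta>, \<omega>) \<partial>MZ \<partial>N)"
    unfolding integral_mult_right_zero[symmetric] g_def
    using J(2) by (simp add: Y_def e_def mult.left_commute cong: restrict_cong)
  also have "\<dots> = (\<integral>p. indicator E (\<lambda>r\<in>J. Y a r p) * Y a s p \<partial>(N \<Otimes>\<^sub>M MZ))"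
    by (rule Q.integral_fst'[OF Y_int[OF st(1)]])
  finally show ?thesis .
qed

lemma martingale_X:
  assumes mart: "martingale MZ Z"
    and lap: "\<And>h. 0 \<le> h \<Longrightarrow> (\<integral>\<eta>. exp (- \<kappa> * \<zeta> h \<eta>) \<partial>N) = exp (- \<kappa> * h)"
  shows "martingale KL.lim X"
  unfolding martingale_def
proof (intro conjI allI impI)
  have Zint: "integrable MZ (Z t)" if "0 \<le> t" for t using mart that by (simp add: martingale_def)
  show Xint: "integrable KL.lim (X t)" if t: "0 \<le> t" for t
  proof -
    have "integrable (distr KL.lim borel (X t)) (\<lambda>x. x)"
      unfolding distr_X_single[OF t] using Zint[OF t] t by (simp add: integrable_distr_eq)
    then show ?thesis using t by (simp add: integrable_distr_eq X_measurable)
  qed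
  fix s t :: real and A assume st: "0 \<le> s" "s \<le> t" and A: "A \<in> nat_filtration KL.lim X s"
  have t: "0 \<le> t" using st by simp
  show "(LINT \<omega>:A|KL.lim. X t \<omega>) = (LINT \<omega>:A|KL.lim. X s \<omega>)"
  proof (rule nat_filtration_set_integral_eqI[OF X_measurable Xint[OF t] Xint[OF st(1)] st(1) _ A])
    fix J and E :: "(real \<Rightarrow> real) set"
    assume J: "finite J" "J \<subseteq> {0..s}" "s \<in> J" and E: "E \<in> sets (PiM J (\<lambda>_. borel))"
    show "(\<integral>\<omega>. indicator E (\<lambda>t\<in>J. X t \<omega>) * X t \<omega> \<partial>KL.lim) = (\<integral>\<omega>. indicator E (\<lambda>t\<in>J. X t \<omega>) * X s \<omega> \<partial>KL.lim)"
    proof (cases "s = 0")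
      \<comment> \<open>Here the claim is that \<open>X t\<close> has mean 0: it has the mean of
        \<open>Z t\<close>, which by the martingale property is that of \<open>Z 0\<close>, and
        \<open>Z 0\<close> vanishes almost surely.\<close>
      case True
      have "(\<integral>\<omega>. X t \<omega> \<partial>KL.lim) = (\<integral>x. x \<partial>distr KL.lim borel (X t))"
        using t by (simp add: integral_distr X_measurable)
      also have "\<dots> = (\<integral>\<omega>. Z t \<omega> \<partial>MZ)"
        unfolding distr_X_single[OF t] using t by (simp add: integral_distr)
      also have "\<dots> = (LINT \<omega>:space MZ|MZ. Z t \<omega>)"
        unfolding set_lebesgue_integral_def by (intro Bochner_Integration.integral_cong) auto
      also have "\<dots> = (LINT \<omega>:space MZ|MZ. Z 0 \<omega>)"
      proof -
        have "space MZ \<in> nat_filtration MZ Z 0"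
          unfolding nat_filtration_def by (rule sigma_sets_top)
        then show ?thesis using mart t unfolding martingale_def by blast
      qed
      also have "\<dots> = (\<integral>\<omega>. 0 \<partial>MZ)"
        unfolding set_lebesgue_integral_def using Z_0 by (intro integral_cong_AE) (auto simp: indicator_def)
      finally show ?thesis
        using J unfolding True by (subst (1 2) X_0_cylinder) (auto simp: X_def)
    next
      case False
      with st have s: "0 < s" by simp
      let ?J = "insert t J"
      let ?a = "base ?J"
      have J': "finite ?J" "?J \<subseteq> {0..}" using J st by auto
      have a: "?a \<le> ln r" if "r \<in> ?J" "0 < r" for r using base_le[OF J'] that by blast
      have f1: "(\<lambda>y. indicator E (restrict y J) * y t :: real) \<in> borel_measurable (PiM ?J (\<lambda>_. borel))"
        by (intro borel_measurable_times measurable_compose[OF measurable_restrict_subset borel_measurable_indicator[OF E]]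
            measurable_component_singleton) auto
      have f2: "(\<lambda>y. indicator E y * y s :: real) \<in> borel_measurable (PiM J (\<lambda>_. borel))"
        using J(3) by (intro borel_measurable_times borel_measurable_indicator E measurable_component_singleton)
      have res: "restrict (\<lambda>r\<in>?J. z r) J = (\<lambda>r\<in>J. z r)" for z :: "real \<Rightarrow> real"
        by (auto simp: restrict_def)
      have "(\<integral>\<eta>. exp (- \<kappa> * \<zeta> (ln (t / s)) \<eta>) \<partial>N) = exp (- \<kappa> * ln (t / s))"
        using s st by (intro lap) simp
      also have "\<dots> = (s / t) powr \<kappa>"
        using s st by (simp add: powr_def ln_div algebra_simps)
      finally have lap': "(\<integral>\<eta>. exp (- \<kappa> * \<zeta> (ln (t / s)) \<eta>) \<partial>N) = (s / t) powr \<kappa>" .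
      have "(\<integral>\<omega>. indicator E (\<lambda>t\<in>J. X t \<omega>) * X t \<omega> \<partial>KL.lim)
          = (\<integral>p. indicator E (\<lambda>t\<in>J. Y ?a t p) * Y ?a t p \<partial>(N \<Otimes>\<^sub>M MZ))"
        using X_integral[OF J' a f1] unfolding res by simp
      also have "\<dots> = (\<integral>p. indicator E (\<lambda>t\<in>J. Y ?a t p) * Y ?a s p \<partial>(N \<Otimes>\<^sub>M MZ))"
        using J by (intro Y_martingale[OF mart lap'] s st(2) a E) auto
      also have "\<dots> = (\<integral>\<omega>. indicator E (\<lambda>t\<in>J. X t \<omega>) * X s \<omega> \<partial>KL.lim)"
        using X_integral[OF J(1) _ _ f2, of ?a] J' a J(3) by simp
      finally show ?thesis .
    qed
  qed
qed

end

theorem theorem2p4: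
  fixes \<kappa> :: real
    and MZ :: "'a measure" and Z :: "real \<Rightarrow> 'a \<Rightarrow> real"
    and P :: "real \<Rightarrow> real \<Rightarrow> real \<Rightarrow> real measure"
    and N :: "'b measure" and \<zeta> :: "real \<Rightarrow> 'b \<Rightarrow> real" and \<psi> :: "real \<Rightarrow> real"
  assumes kappa_pos: "\<kappa> > 0"
    and Z_markov: "markov_process MZ Z P"
    and P_joint: "jointly_measurable_kernels P"
    and Z_cadlag: "\<forall>\<omega>\<in>space MZ. cadlag_path (\<lambda>t. Z t \<omega>)"
    and Z_ss: "self_similar MZ Z \<kappa>"
    and sub: "subordinator N \<zeta>"
    and lap: "laplace_exponent N \<zeta> \<psi>"
  shows "\<exists>(M :: (real \<Rightarrow> real) measure) (X :: real \<Rightarrow> (real \<Rightarrow> real) \<Rightarrow> real).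
           markov_process M X (ss_transition \<kappa> P (R_law N \<zeta>))
         \<and> (\<forall>\<omega>\<in>space M. X 0 \<omega> = 0)
         \<and> self_similar M X \<kappa>
         \<and> (\<forall>t\<ge>0. distr M borel (X t) = distr MZ borel (Z t))
         \<and> ((martingale MZ Z \<and> \<psi> \<kappa> = \<kappa>) \<longrightarrow> martingale M X)"
proof -
  interpret subordinated_self_similar N \<zeta> \<kappa> MZ Z P
    by unfold_locales (fact assms)+
  have "martingale KL.lim X" if "martingale MZ Z" "\<psi> \<kappa> = \<kappa>"
  proof (rule martingale_X[OF that(1)])
    fix h :: real assume "0 \<le> h"
    then show "(\<integral>\<eta>. exp (- \<kappa> * \<zeta> h \<eta>) \<partial>N) = exp (- \<kappa> * h)"
      using lap kappa_pos that(2) by (simp add: laplace_exponent_def mult.commute)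
  qed
  then show ?thesis
    using markov_X self_similar_X distr_X_single
    by (intro exI[of _ KL.lim] exI[of _ X]) (auto simp: X_def)
qed

end
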